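(* In the median process on $\mathbb{T}_3$, almost surely all connected components of the disagreement graph are finite. Furthermore, almost surely, for any component $\mathcal{C}$ of the disagreement graph, there are vertices $w,z\in\mathcal{C}$ (possibly equal) such that $\mathcal{C}$ is equal to the path in $\mathbb{T}_3$ between $w$ and $z$.
   Context: $\mathbb{T}_3$ is the infinite $3$-regular tree with vertex set $\mathcal{V}$ and edge set $\mathcal{E}$; $\partial x$ is the set of the three neighbors of $x$. The median process $U(t)=(U_x(t))_{x\in\mathcal{V}}\in[0,1]^{\mathcal{V}}$, $t\ge0$: the initial values $U_x(0)$, $x\in\mathcal{V}$, are i.i.d. uniform on $[0,1]$, and, independently, each vertex carries an independent rate-one Poisson process (its clock). Values are constant between clock rings; when the clock of $x$ rings at time $t$, $U_x(t)=\mathrm{median}\{U_y(t^-):y\in\partial x\}$. Almost surely the limit $U_x(\infty)=\lim_{t\to\infty}U_x(t)$ exists for every $x\in\mathcal{V}$. The disagreement graph is the subgraph of $\mathbb{T}_3$ with vertex set $\mathcal{V}$ whose edges are those $\{x,y\}\in\mathcal{E}$ with $U_x(\infty)\ne U_y(\infty)$. *)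

theory Defs
  imports "HOL-Probability.Probability"
begin

section \<open>Simple graphs\<close>

text \<open>
  A simple graph is given by its set of edges, each a two-element set of vertices; its vertex set
  is the whole type. The digraphs of the AFP entry Graph Theory are not suitable here: there, the
  two arcs of an undirected edge form a cycle, so a symmetric digraph with an arc is never a tree.
\<close>

definition neighbors :: "'v set set \<Rightarrow> 'v \<Rightarrow> 'v set" where
  "neighbors E x = {y. {x, y} \<in> E}"

definition is_path :: "'v set set \<Rightarrow> 'v list \<Rightarrow> bool" where
  "is_path E p \<longleftrightarrow> p \<noteq> [] \<and> distinct p \<and> successively (\<lambda>x y. {x, y} \<in> E) p"

definition path_between :: "'v set set \<Rightarrow> 'v \<Rightarrow> 'v list \<Rightarrow> 'v \<Rightarrow> bool" where
  "path_between E x p y \<longleftrightarrow> is_path E p \<and> hd p = x \<and> last p = y"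

definition path_edges :: "'v list \<Rightarrow> 'v set set" where
  "path_edges p = {{p ! i, p ! Suc i} | i. Suc i < length p}"

definition is_cycle :: "'v set set \<Rightarrow> 'v list \<Rightarrow> bool" where
  "is_cycle E p \<longleftrightarrow> 3 \<le> length p \<and> is_path E p \<and> {last p, hd p} \<in> E"

text \<open>
  For \<open>d = 3\<close> (indeed for all \<open>d \<ge> 2\<close>) such a tree is automatically infinite, and it is unique up
  to isomorphism.
\<close>

definition regular_tree :: "nat \<Rightarrow> 'v set set \<Rightarrow> bool" where
  "regular_tree d E \<longleftrightarrow>
     (\<forall>e\<in>E. card e = 2) \<and>
     (\<forall>x y. \<exists>p. path_between E x p y) \<and>
     (\<nexists>p. is_cycle E p) \<and>
     (\<forall>x. finite (neighbors E x) \<and> card (neighbors E x) = d)"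

definition graph_components :: "'v set set \<Rightarrow> 'v set set" where
  "graph_components F = {{y. (x, y) \<in> {(a, b). {a, b} \<in> F}\<^sup>*} | x. True}"


section \<open>Poisson processes\<close>

text \<open>
  Counting processes on the time set \<open>[0, \<infinity>)\<close>; the values at negative times are irrelevant.
  The truncated difference of natural numbers is harmless, as almost all paths are nondecreasing.
\<close>

definition poisson_process :: "'w measure \<Rightarrow> real \<Rightarrow> (real \<Rightarrow> 'w \<Rightarrow> nat) \<Rightarrow> bool" where
  "poisson_process M r N \<longleftrightarrow>
     (\<forall>t\<ge>0. N t \<in> measurable M (count_space UNIV)) \<and>
     (AE \<omega> in M. N 0 \<omega> = 0 \<and> mono_on {0..} (\<lambda>t. N t \<omega>) \<and>
        (\<forall>t\<ge>0. continuous (at_right t) (\<lambda>s. N s \<omega>))) \<and>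
     (\<forall>s t. 0 \<le> s \<and> s < t \<longrightarrow>
        distr M (count_space UNIV) (\<lambda>\<omega>. N t \<omega> - N s \<omega>) = measure_pmf (poisson_pmf (r * (t - s)))) \<and>
     (\<forall>n (t :: nat \<Rightarrow> real). 0 \<le> t 0 \<and> mono t \<longrightarrow>
        prob_space.indep_vars M (\<lambda>_. count_space UNIV)
          (\<lambda>i \<omega>. N (t (Suc i)) \<omega> - N (t i) \<omega>) {..<n})"

text \<open>The jump times of a path of a counting process.\<close>

definition rings :: "(real \<Rightarrow> nat) \<Rightarrow> real set" where
  "rings n = {t. 0 < t \<and> (\<forall>s. 0 \<le> s \<and> s < t \<longrightarrow> n s < n t)}"


section \<open>The median process\<close>

text \<open>
  The median of a multiset of odd size. Multiplicities matter: neighbouring vertices may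
  carry equal values.
\<close>

definition median :: "real multiset \<Rightarrow> real" where
  "median A = sorted_list_of_multiset A ! (size A div 2)"

definition left_limit :: "(real \<Rightarrow> real) \<Rightarrow> real \<Rightarrow> real" where
  "left_limit f t = Lim (at_left t) f"

text \<open>
  \<open>N x t\<close> is the number of rings of the clock of \<open>x\<close> up to time \<open>t\<close>, and \<open>U x t\<close> is the value
  at \<open>x\<close> at time \<open>t\<close>; only times \<open>t \<ge> 0\<close> are meaningful. The family of initial values and
  the family of clocks have different types, so that their independence is that of the
  \<open>\<sigma>\<close>-algebras they generate (\<open>indep_var\<close> requires a common type).
\<close>

locale median_process = prob_space M
  for M :: "'w measure"
    and E :: "'v set set"
    and N :: "'v \<Rightarrow> real \<Rightarrow> 'w \<Rightarrow> nat"
    and U :: "'v \<Rightarrow> real \<Rightarrow> 'w \<Rightarrow> real" +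
  assumes initial_uniform: "\<And>x. distr M borel (U x 0) = uniform_measure lborel {0..1}"
    and initial_indep: "indep_vars (\<lambda>_. borel) (\<lambda>x. U x 0) UNIV"
    and clocks_poisson: "\<And>x. poisson_process M 1 (N x)"
    and clocks_indep:
      "indep_vars (\<lambda>_. PiM {0..} (\<lambda>_. count_space UNIV)) (\<lambda>x \<omega>. \<lambda>t\<in>{0..}. N x t \<omega>) UNIV"
    and initial_clocks_indep:
      "indep_set
         (sets (vimage_algebra (space M) (\<lambda>\<omega> x. U x 0 \<omega>) (PiM UNIV (\<lambda>_. borel))))
         (sets (vimage_algebra (space M) (\<lambda>\<omega> x. \<lambda>t\<in>{0..}. N x t \<omega>)
            (PiM UNIV (\<lambda>_. PiM {0..} (\<lambda>_. count_space UNIV)))))"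
    and values_in_unit: "AE \<omega> in M. \<forall>x. \<forall>t\<ge>0. U x t \<omega> \<in> {0..1}"
    and constant_between_rings:
      "AE \<omega> in M. \<forall>x s t. 0 \<le> s \<and> s \<le> t \<and> {s<..t} \<inter> rings (\<lambda>t. N x t \<omega>) = {} \<longrightarrow>
         U x t \<omega> = U x s \<omega>"
    and update_at_rings:
      "AE \<omega> in M. \<forall>x. \<forall>t \<in> rings (\<lambda>t. N x t \<omega>).
         U x t \<omega> =
           median (image_mset (\<lambda>y. left_limit (\<lambda>s. U y s \<omega>) t) (mset_set (neighbors E x)))"

definition limit_value :: "('v \<Rightarrow> real \<Rightarrow> 'w \<Rightarrow> real) \<Rightarrow> 'v \<Rightarrow> 'w \<Rightarrow> real" where
  "limit_value U x \<omega> = Lim at_top (\<lambda>t. U x t \<omega>)"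

text \<open>The edge set of the disagreement graph, whose vertex set is again the whole type.\<close>

definition disagreement_edges ::
    "'v set set \<Rightarrow> ('v \<Rightarrow> real \<Rightarrow> 'w \<Rightarrow> real) \<Rightarrow> 'w \<Rightarrow> 'v set set" where
  "disagreement_edges E U \<omega> = {{x, y} | x y. {x, y} \<in> E \<and> limit_value U x \<omega> \<noteq> limit_value U y \<omega>}"

end

theory Submission
  imports Defs "HOL-Library.Sublist"
begin

text \<open>
  Almost surely the limit \<open>V x\<close> of \<open>U x\<close> exists at every vertex and equals the median of the
  limits at the three neighbors, because clocks ring at arbitrarily late times and the median is
  continuous. So every vertex has at most one neighbor with a larger and at most one neighbor with a
  smaller limit: a component of the disagreement graph is a chain along which \<open>V\<close> is strictly monotone
  (\<open>component_is_rising_path\<close>). The theorem therefore amounts to two probabilistic facts, both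
  consequences of invariance under automorphisms of the tree: the limits exist, and there is no infinite
  monotone chain.

  Invariance. Cut time into cells of length \<open>2\<^sup>-\<^sup>m\<close> and let the vertices whose clocks ring in a cell
  update simultaneously. This synchronous dynamics is an explicit equivariant function of i.i.d. inputs
  attached to the vertices, so its law is invariant (\<open>expectation_automorphism\<close>). It agrees with the median
  process up to any given time once \<open>m\<close> is large (\<open>AE_approx_eq\<close>): within a time slot of length \<open>1/8\<close> the
  vertices that ring form finite clusters, and for large \<open>m\<close> no cell contains rings of two neighbors. This
  comparison uses only the rules that the process obeys, so it also shows that these rules determine
  the process. The automorphism group of the tree is rich: any path can be mapped
  to any other path of the same length (\<open>tree_path_transitive\<close>), in particular to its own reversal, and
  this replaces the usual mass-transport principle.

  Convergence. The median of three numbers minimises the sum of the distances to them, and an update that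
  moves a value by \<open>d\<close> lowers this sum by at least \<open>d\<close>. By invariance the expected discrepancy
  along an edge does not depend on the edge, and it lies in \<open>[0,1]\<close>; hence the expected total
  variation of \<open>U x\<close> is finite (\<open>expected_variation\<close>), the error from simultaneous
  updates of neighbors vanishing with the length of the cells.

  No infinite chain. For a path \<open>p\<close> along which \<open>V\<close> increases let its weight be the first increment
  \<open>V (p ! 1) - V (p ! 0)\<close>, and \<open>0\<close> for all other paths. By reversal invariance the expected total
  weight of the paths with \<open>n\<close> edges that start at \<open>x\<close> equals that of those that end at \<open>x\<close>. The
  latter, summed over \<open>n\<close>, telescope to at most \<open>V x \<le> 1\<close>. The former are bounded below uniformly in \<open>n\<close>
  if an infinite increasing chain starts at \<open>x\<close>. So such a chain has probability \<open>0\<close> (\<open>AE_rising_bounded\<close>), and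
  replacing \<open>V\<close> by \<open>1 - V\<close> excludes infinite decreasing chains.
\<close>

section \<open>Paths and automorphisms of regular trees\<close>

lemma is_path_Cons:
  "is_path E (v # s) \<longleftrightarrow> v \<notin> set s \<and> (s = [] \<or> {v, hd s} \<in> E \<and> is_path E s)"
  by (cases s) (auto simp: is_path_def)

lemma is_path_append:
  "p \<noteq> [] \<Longrightarrow> q \<noteq> [] \<Longrightarrow> is_path E (p @ q) \<longleftrightarrow>
     is_path E p \<and> is_path E q \<and> set p \<inter> set q = {} \<and> {last p, hd q} \<in> E"
  by (auto simp: is_path_def successively_append_iff)

lemma is_path_rev: "is_path E (rev p) \<longleftrightarrow> is_path E p"
  by (simp add: is_path_def insert_commute)

lemma is_path_suffix: "is_path E (r @ s) \<Longrightarrow> s \<noteq> [] \<Longrightarrow> is_path E s"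
  by (cases "r = []") (auto simp: is_path_append)

lemma is_path_prefix: "is_path E (r @ s) \<Longrightarrow> r \<noteq> [] \<Longrightarrow> is_path E r"
  by (cases "s = []") (auto simp: is_path_append)

text \<open>
  Two different paths with the same ends separate at some vertex \<open>x\<close>; following the first one until it
  meets the second again, and the second one back to \<open>x\<close>, gives a cycle.
\<close>
lemma tree_path_unique:
  assumes nocyc: "\<nexists>c. is_cycle E c"
  shows "path_between E x p y \<Longrightarrow> path_between E x q y \<Longrightarrow> p = q"
proof (induction p arbitrary: x q)
  case Nil
  then show ?case by (simp add: path_between_def is_path_def)
next
  case (Cons a p)
  from Cons.prems(1) have a: "a = x" by (simp add: path_between_def)
  from Cons.prems(2) obtain q' where q: "q = x # q'"
    by (cases q) (auto simp: path_between_def is_path_def)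
  show ?case
  proof (cases "p = [] \<or> q' = []")
    case True
    with Cons.prems a q show ?thesis
      by (auto simp: path_between_def is_path_Cons split: if_splits)
  next
    case False
    then have ne: "p \<noteq> []" "q' \<noteq> []" by auto
    have P: "is_path E p" "x \<notin> set p" "{x, hd p} \<in> E" "last p = y"
      using Cons.prems(1) ne a by (auto simp: path_between_def is_path_Cons)
    have Q: "is_path E q'" "x \<notin> set q'" "{x, hd q'} \<in> E" "last q' = y"
      using Cons.prems(2) ne q by (auto simp: path_between_def is_path_Cons)
    show ?thesis
    proof (cases "hd p = hd q'")
      case True
      have "p = q'"
        by (rule Cons.IH[of "hd p"]) (use P Q True in \<open>auto simp: path_between_def\<close>)
      then show ?thesis using a q by simp
    next
      case False
      have "\<exists>c\<in>set p. c \<in> set q'"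
        using P(4) Q(4) ne by (metis last_in_set)
      then obtain p1 c p2 where p: "p = p1 @ c # p2" "c \<in> set q'" "\<forall>z\<in>set p1. z \<notin> set q'"
        by (elim split_list_first_propE) auto
      obtain q1 q2 where q': "q' = q1 @ c # q2" using p(2) by (meson split_list)
      have c1: "is_path E (p1 @ [c])" using P(1) p(1) is_path_prefix[of E "p1 @ [c]" p2] by simp
      have c2: "is_path E (q1 @ [c])" using Q(1) q' is_path_prefix[of E "q1 @ [c]" q2] by simp
      let ?t = "p1 @ c # rev q1"
      have "is_path E ?t"
      proof (cases "q1 = []")
        case True then show ?thesis using c1 by simp
      next
        case F: False
        have "is_path E (rev q1)" using c2 F is_path_prefix by (simp add: is_path_rev) blast
        moreover have "set (p1 @ [c]) \<inter> set (rev q1) = {}" "{last q1, c} \<in> E"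
          using p(3) q' c2 F by (auto simp: is_path_append)
        ultimately show ?thesis
          using is_path_append[of "p1 @ [c]" "rev q1" E] c1 F
          by (simp add: hd_rev insert_commute)
      qed
      moreover have "hd ?t = hd p" using p(1) by (cases p1) auto
      moreover have l: "last ?t = hd q'" using q' by (cases q1) auto
      moreover have "x \<notin> set ?t" using P(2) Q(2) p(1) q' by auto
      ultimately have "is_path E (x # ?t)" using P(3) by (simp add: is_path_Cons)
      moreover have "3 \<le> length (x # ?t)"
        using False p(1) q' by (cases p1; cases q1) auto
      moreover have "{last (x # ?t), hd (x # ?t)} \<in> E"
        using Q(3) l by (simp add: insert_commute del: last_append)
      ultimately show ?thesis using nocyc unfolding is_cycle_def by blast
    qed
  qed
qed

lemma exists_bij_betw_pointed:
  assumes "finite A" "finite B" "card A = card B" "a \<in> A" "b \<in> B"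
  shows "\<exists>f. bij_betw f A B \<and> f a = b"
proof -
  have "card (A - {a}) = card (B - {b})" using assms by simp
  then obtain g where g: "bij_betw g (A - {a}) (B - {b})"
    using finite_same_card_bij assms by (metis finite_Diff)
  have "bij_betw (g(a := b)) (A - {a}) (B - {b})"
    using g by (rule bij_betw_cong[THEN iffD1, rotated]) auto
  then have "bij_betw (g(a := b)) (insert a (A - {a})) (insert b (B - {b}))"
    using notIn_Un_bij_betw[of a "A - {a}" "g(a := b)" "B - {b}"] by simp
  then show ?thesis using assms(4,5) by (metis fun_upd_same insert_Diff)
qed

definition automorphism :: "'v set set \<Rightarrow> ('v \<Rightarrow> 'v) \<Rightarrow> bool" where
  "automorphism E \<phi> \<longleftrightarrow> bij \<phi> \<and> (\<forall>x. neighbors E (\<phi> x) = \<phi> ` neighbors E x)"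

text \<open>
  Paths towards the root \<open>x\<close>, the root being the last element, so that structural recursion
  on lists moves away from the root. The empty list is included: the root itself is then an extension
  like any other vertex.
\<close>
definition rooted_path :: "'v set set \<Rightarrow> 'v \<Rightarrow> 'v list \<Rightarrow> bool" where
  "rooted_path E x s \<longleftrightarrow> s = [] \<or> is_path E s \<and> last s = x"

definition extensions :: "'v set set \<Rightarrow> 'v \<Rightarrow> 'v list \<Rightarrow> 'v set" where
  "extensions E x s = {v. rooted_path E x (v # s)}"

lemma rooted_path_tl: "rooted_path E x (v # s) \<Longrightarrow> rooted_path E x s"
  by (auto simp: rooted_path_def is_path_Cons split: if_splits)

lemma tree_path_neighbor:
  assumes nocyc: "\<nexists>c. is_cycle E c" and p: "is_path E (u # s)" and v: "v \<in> set s" "{u, v} \<in> E"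
  shows "v = hd s"
proof -
  obtain s1 s2 where s: "s = s1 @ v # s2" using v(1) by (meson split_list)
  have "is_path E (u # s1 @ [v])"
    using p s is_path_prefix[of E "u # s1 @ [v]" s2] by simp
  moreover have "{last (u # s1 @ [v]), hd (u # s1 @ [v])} \<in> E" using v(2) by (simp add: insert_commute)
  ultimately have "\<not> 3 \<le> length (u # s1 @ [v])" using nocyc unfolding is_cycle_def by blast
  then show ?thesis using s by (cases s1) auto
qed

text \<open>
  A path in a regular tree can be extended in a number of ways that depends on its length alone. This is
  what makes the tree homogeneous.
\<close>
lemma extensions_card:
  assumes tr: "regular_tree d E" and s: "rooted_path E x s"
  shows "finite (extensions E x s)"
    and "card (extensions E x s) = (case s of [] \<Rightarrow> 1 | [_] \<Rightarrow> d | _ \<Rightarrow> d - 1)"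
proof -
  have nocyc: "\<nexists>c. is_cycle E c" and fin: "\<And>x. finite (neighbors E x)"
    and d: "\<And>x. card (neighbors E x) = d" and two: "\<And>e. e \<in> E \<Longrightarrow> card e = 2"
    using tr by (auto simp: regular_tree_def)
  have irr: "{v, v} \<notin> E" for v using two[of "{v, v}"] by auto
  have "finite (extensions E x s) \<and>
    card (extensions E x s) = (case s of [] \<Rightarrow> 1 | [_] \<Rightarrow> d | _ \<Rightarrow> d - 1)"
  proof (cases s)
    case Nil
    then have "extensions E x s = {x}"
      by (auto simp: extensions_def rooted_path_def is_path_Cons)
    then show ?thesis using Nil by simp
  next
    case (Cons u t)
    then have p: "is_path E (u # t)" "last (u # t) = x" using s by (auto simp: rooted_path_def)
    have ext: "extensions E x s = neighbors E u - set t"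
      using p irr Cons
      by (auto simp: extensions_def rooted_path_def is_path_Cons neighbors_def insert_commute)
    show ?thesis
    proof (cases t)
      case Nil then show ?thesis using ext Cons fin d by simp
    next
      case C2: (Cons w t')
      have "neighbors E u \<inter> set t = {w}"
        using tree_path_neighbor[OF nocyc p(1)] p(1) C2 by (auto simp: neighbors_def is_path_Cons)
      then have "neighbors E u - set t = neighbors E u - {w}" "w \<in> neighbors E u" by auto
      then show ?thesis using ext Cons C2 fin d by simp
    qed
  qed
  then show "finite (extensions E x s)"
    and "card (extensions E x s) = (case s of [] \<Rightarrow> 1 | [_] \<Rightarrow> d | _ \<Rightarrow> d - 1)" by auto
qed

text \<open>
  Given bijections \<open>\<beta> s s'\<close> between the extensions of paths of equal length, this is the isomorphism of the
  trees of rooted paths that they induce.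
\<close>
primrec map_path :: "('v list \<Rightarrow> 'v list \<Rightarrow> 'v \<Rightarrow> 'v) \<Rightarrow> 'v list \<Rightarrow> 'v list" where
  "map_path \<beta> [] = []"
| "map_path \<beta> (v # s) = \<beta> s (map_path \<beta> s) v # map_path \<beta> s"

lemma length_map_path [simp]: "length (map_path \<beta> s) = length s"
  by (induction s) auto

text \<open>
  Root one copy of the tree at the last vertex of \<open>p\<close>, another at that of \<open>q\<close>. Vertices correspond to
  paths to the root, so it suffices to match the extensions of each rooted path with those of its image,
  which are equally many. Along \<open>p\<close> itself the matching may be prescribed.
\<close>
lemma tree_path_transitive:
  assumes tr: "regular_tree d E" and p: "is_path E p" and q: "is_path E q"
    and len: "length p = length q"
  shows "\<exists>\<phi>. automorphism E \<phi> \<and> map \<phi> p = q"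
proof -
  define x where "x = last p"
  define x' where "x' = last q"
  have nocyc: "\<nexists>c. is_cycle E c" and fin: "\<And>x. finite (neighbors E x)"
    and d: "\<And>x. card (neighbors E x) = d" and conn: "\<And>x y. \<exists>p. path_between E x p y"
    using tr by (auto simp: regular_tree_def)
  note uniq = tree_path_unique[OF nocyc]
  have rp: "rooted_path E x p" "rooted_path E x' q"
    using p q by (auto simp: rooted_path_def x_def x'_def)
  \<comment> \<open>Matching of extensions that also respects the prescribed paths.\<close>
  define good where "good s s' b \<longleftrightarrow> bij_betw b (extensions E x s) (extensions E x' s') \<and>
     (\<forall>v v'. suffix (v # s) p \<and> suffix (v' # s') q \<longrightarrow> b v = v')" for s s' b
  define \<beta> where "\<beta> s s' = (SOME b. good s s' b)" for s s'
  have good: "good s s' (\<beta> s s')"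
    if s: "rooted_path E x s" "rooted_path E x' s'" "length s = length s'" for s s'
  proof -
    have card: "finite (extensions E x s)" "finite (extensions E x' s')"
      "card (extensions E x s) = card (extensions E x' s')"
      using extensions_card[OF tr s(1)] extensions_card[OF tr s(2)] s(3)
      by (auto split: list.splits)
    have "\<exists>b. good s s' b"
    proof (cases "\<exists>v v'. suffix (v # s) p \<and> suffix (v' # s') q")
      case True
      then obtain v v' where vv: "suffix (v # s) p" "suffix (v' # s') q" by auto
      have ext: "rooted_path E y (w # r)" if "rooted_path E y t" "suffix (w # r) t" for y w r t
        using that by (auto simp: rooted_path_def suffix_def dest: is_path_suffix)
      have "v \<in> extensions E x s" "v' \<in> extensions E x' s'"
        using ext[OF rp(1) vv(1)] ext[OF rp(2) vv(2)] by (auto simp: extensions_def)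
      then obtain b where b: "bij_betw b (extensions E x s) (extensions E x' s')" "b v = v'"
        using exists_bij_betw_pointed card by metis
      have same: "w = v" if "suffix (w # r) t" "suffix (v # r) t" for w v r and t :: "'a list"
      proof -
        from that obtain a b where "t = (a @ [w]) @ r" "t = (b @ [v]) @ r" by (auto simp: suffix_def)
        then have "a @ [w] = b @ [v]" by (metis append_same_eq)
        then show ?thesis by simp
      qed
      have "good s s' b" unfolding good_def using b vv same by metis
      then show ?thesis by blast
    next
      case False
      then show ?thesis using finite_same_card_bij[OF card] unfolding good_def by blast
    qed
    then show ?thesis unfolding \<beta>_def by (rule someI_ex)
  qed
  let ?\<Phi> = "map_path \<beta>"
  have \<Phi>_rp: "rooted_path E x' (?\<Phi> s)" if "rooted_path E x s" for s
    using that
  proof (induction s)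
    case Nil then show ?case by (simp add: rooted_path_def)
  next
    case (Cons v s)
    then have s: "rooted_path E x s" "v \<in> extensions E x s" 
      by (auto simp: extensions_def intro: rooted_path_tl)
    then have "\<beta> s (?\<Phi> s) v \<in> extensions E x' (?\<Phi> s)"
      using good[OF s(1) Cons.IH[OF s(1)]] unfolding good_def by (auto dest: bij_betwE)
    then show ?case by (simp add: extensions_def)
  qed
  have \<Phi>_inj: "s = t" if "rooted_path E x s" "rooted_path E x t" "?\<Phi> s = ?\<Phi> t" for s t
    using that
  proof (induction s arbitrary: t)
    case Nil then show ?case by (cases t) auto
  next
    case (Cons v s)
    then obtain w t' where t: "t = w # t'" by (cases t) auto
    have st: "s = t'" using Cons.prems t by (intro Cons.IH) (auto intro: rooted_path_tl)
    have "inj_on (\<beta> s (?\<Phi> s)) (extensions E x s)"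
      using good[of s "?\<Phi> s"] \<Phi>_rp[of s] Cons.prems rooted_path_tl[of E x v s]
      unfolding good_def by (auto dest: bij_betw_imp_inj_on)
    then have "v = w" using Cons.prems t st by (auto simp: inj_on_def extensions_def)
    then show ?case using st t by simp
  qed
  have \<Phi>_suffix: "suffix (?\<Phi> s) q" if "suffix s p" for s
    using that
  proof (induction s)
    case Nil then show ?case by simp
  next
    case (Cons v s)
    then have s: "suffix s p" by (auto simp: suffix_def)
    have "rooted_path E x s" using s rp(1) 
      by (cases "s = []") (auto simp: rooted_path_def suffix_def dest: is_path_suffix)
    note g = good[OF this \<Phi>_rp[OF this]]
    have "length s < length q" using suffix_length_le[OF Cons.prems] len by simp
    obtain r where r: "q = r @ ?\<Phi> s" using Cons.IH[OF s] by (auto simp: suffix_def)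
    have "r \<noteq> []" using \<open>length s < length q\<close> r by auto
    then obtain r' v' where "r = r' @ [v']" by (metis rev_exhaust)
    then have "suffix (v' # ?\<Phi> s) q" using r by (simp add: suffix_def)
    then have "\<beta> s (?\<Phi> s) v = v'" using g Cons.prems unfolding good_def by simp
    then show ?case using \<open>suffix (v' # ?\<Phi> s) q\<close> by simp
  qed
  have "?\<Phi> p = q"
    using \<Phi>_suffix[of p] len by (auto simp: suffix_def)
  have rp_ex: "\<exists>s. rooted_path E x s \<and> s \<noteq> [] \<and> hd s = v" for x v
    using conn[of v x] by (auto simp: rooted_path_def path_between_def is_path_def)
  have rp_uniq: "s = t"
    if "rooted_path E y s" "rooted_path E y t" "s \<noteq> []" "t \<noteq> []" "hd s = hd t" for s t y
    using that by (intro uniq[of "hd s" s y t]) (auto simp: rooted_path_def path_between_def)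
  define \<rho> where "\<rho> v = (SOME s. rooted_path E x s \<and> s \<noteq> [] \<and> hd s = v)" for v
  have \<rho>: "rooted_path E x (\<rho> v)" "\<rho> v \<noteq> []" "hd (\<rho> v) = v" for v
    using someI_ex[OF rp_ex[of x v]] unfolding \<rho>_def by auto
  \<comment> \<open>The image of a vertex is the far end of the image of the path between the vertex and the root.\<close>
  define \<phi> where "\<phi> v = hd (?\<Phi> (\<rho> v))" for v
  have \<phi>_hd: "\<phi> v = hd (?\<Phi> (v # s))" if "rooted_path E x (v # s)" for v s
    using rp_uniq[OF \<rho>(1) that] \<rho>[of v] unfolding \<phi>_def by simp
  have map: "map \<phi> s = ?\<Phi> s" if "rooted_path E x s" for s
    using that
  proof (induction s)
    case (Cons v s)
    then show ?case using \<phi>_hd[OF Cons.prems] rooted_path_tl[OF Cons.prems] by simp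
  qed simp
  have "inj \<phi>"
  proof (rule injI)
    fix u v assume eq: "\<phi> u = \<phi> v"
    have ne: "?\<Phi> (\<rho> w) \<noteq> []" for w using \<rho>(2)[of w] by (cases "\<rho> w") auto
    have "?\<Phi> (\<rho> u) = ?\<Phi> (\<rho> v)"
      using rp_uniq[OF \<Phi>_rp[OF \<rho>(1)] \<Phi>_rp[OF \<rho>(1)] ne ne] eq by (simp add: \<phi>_def)
    then have "\<rho> u = \<rho> v" using \<Phi>_inj \<rho>(1) by blast
    then show "u = v" using \<rho>(3) by metis
  qed
  have step: "{\<phi> u, \<phi> v} \<in> E" if uv: "{u, v} \<in> E" for u v
  proof -
    have ne: "u \<noteq> v" using uv tr by (auto simp: regular_tree_def)
    have ext: "{\<phi> a, \<phi> b} \<in> E" if "rooted_path E x (a # b # s)" for a b s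
      using \<Phi>_rp[OF that] map[OF that] by (auto simp: rooted_path_def is_path_Cons)
    obtain s where s: "\<rho> u = u # s" using \<rho>[of u] by (cases "\<rho> u") auto
    have pu: "is_path E (u # s)" "last (u # s) = x"
      using \<rho>(1)[of u] s by (auto simp: rooted_path_def)
    show ?thesis
    proof (cases "v \<in> set s")
      case True
      then have "v = hd s" "s \<noteq> []" using tree_path_neighbor[OF nocyc pu(1)] uv by auto
      then have "rooted_path E x (u # v # tl s)" using \<rho>(1)[of u] s by simp
      then show ?thesis by (rule ext)
    next
      case False
      then have "rooted_path E x (v # u # s)"
        using pu ne uv by (auto simp: rooted_path_def is_path_Cons insert_commute)
      then show ?thesis using ext by (metis insert_commute)
    qed
  qed
  have nb: "neighbors E (\<phi> u) = \<phi> ` neighbors E u" for u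
  proof (rule sym, rule card_subset_eq)
    show "\<phi> ` neighbors E u \<subseteq> neighbors E (\<phi> u)" using step by (auto simp: neighbors_def)
    show "card (\<phi> ` neighbors E u) = card (neighbors E (\<phi> u))"
      using d card_image[OF inj_on_subset[OF \<open>inj \<phi>\<close> subset_UNIV]] by simp
  qed (rule fin)
  \<comment> \<open>The range of \<open>\<phi>\<close> is closed under neighbors, and the tree is connected.\<close>
  have "surj \<phi>"
  proof -
    have "set s \<subseteq> range \<phi>" if "is_path E s" "last s \<in> range \<phi>" for s
      using that
    proof (induction s)
      case (Cons v s)
      show ?case
      proof (cases "s = []")
        case True then show ?thesis using Cons.prems by simp
      next
        case False
        then have "{v, hd s} \<in> E" "set s \<subseteq> range \<phi>" using Cons by (auto simp: is_path_Cons)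
        moreover obtain w where "hd s = \<phi> w" using calculation(2) False hd_in_set by blast
        ultimately have "v \<in> neighbors E (\<phi> w)" by (simp add: neighbors_def insert_commute)
        then show ?thesis using nb[of w] \<open>set s \<subseteq> range \<phi>\<close> by auto
      qed
    qed simp
    moreover have "\<exists>s. is_path E s \<and> hd s = v \<and> last s = \<phi> x" for v
      using conn[of v "\<phi> x"] by (auto simp: path_between_def)
    ultimately show ?thesis by (metis hd_in_set is_path_def rangeI subset_iff surj_def UNIV_eq_I image_iff)
  qed
  with \<open>inj \<phi>\<close> have "automorphism E \<phi>" using nb by (simp add: automorphism_def bij_def)
  moreover have "map \<phi> p = q" using map[OF rp(1)] \<open>?\<Phi> p = q\<close> by simp
  ultimately show ?thesis by blast
qed

definition paths_from :: "'v set set \<Rightarrow> 'v \<Rightarrow> nat \<Rightarrow> 'v list set" where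
  "paths_from E x n = {p. is_path E p \<and> hd p = x \<and> length p = n}"

lemma paths_from_bound:
  assumes tr: "regular_tree d E"
  shows "finite (paths_from E x (Suc n)) \<and> card (paths_from E x (Suc n)) \<le> d ^ n"
proof (induction n arbitrary: x)
  case 0
  have "paths_from E x (Suc 0) = {[x]}"
    by (auto simp: paths_from_def length_Suc_conv is_path_def)
  then show ?case by simp
next
  case (Suc n)
  have fin: "finite (neighbors E x)" and d: "card (neighbors E x) = d"
    using tr by (auto simp: regular_tree_def)
  have sub: "paths_from E x (Suc (Suc n)) \<subseteq> (\<Union>y\<in>neighbors E x. (#) x ` paths_from E y (Suc n))"
  proof
    fix p assume p: "p \<in> paths_from E x (Suc (Suc n))"
    then obtain s where s: "p = x # s" "s \<noteq> []" by (cases p; cases "tl p") (auto simp: paths_from_def)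
    with p have "hd s \<in> neighbors E x" "s \<in> paths_from E (hd s) (Suc n)"
      by (auto simp: paths_from_def is_path_Cons neighbors_def)
    with s show "p \<in> (\<Union>y\<in>neighbors E x. (#) x ` paths_from E y (Suc n))" by blast
  qed
  have "card (\<Union>y\<in>neighbors E x. (#) x ` paths_from E y (Suc n)) \<le> 
      (\<Sum>y\<in>neighbors E x. card ((#) x ` paths_from E y (Suc n)))"
    by (rule card_UN_le[OF fin])
  also have "\<dots> \<le> (\<Sum>y\<in>neighbors E x. d ^ n)"
    using Suc.IH by (intro sum_mono) (metis card_image_le le_trans)
  finally have "card (\<Union>y\<in>neighbors E x. (#) x ` paths_from E y (Suc n)) \<le> d ^ Suc n"
    using d by simp
  moreover have "finite (\<Union>y\<in>neighbors E x. (#) x ` paths_from E y (Suc n))"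
    using fin Suc.IH by auto
  ultimately show ?case using sub by (meson card_mono finite_subset le_trans)
qed

lemma finite_paths_from: "regular_tree d E \<Longrightarrow> finite (paths_from E x n)"
  using paths_from_bound[of d E x "n - 1"] by (cases n) (auto simp: paths_from_def is_path_def)

lemma countable_vertices:
  assumes "regular_tree d (E :: 'v set set)"
  shows "countable (UNIV :: 'v set)"
proof -
  fix x :: 'v
  have "y \<in> (\<Union>n. last ` paths_from E x n)" for y
  proof -
    obtain p where "path_between E x p y" using assms unfolding regular_tree_def by blast
    then show ?thesis by (auto simp: paths_from_def path_between_def)
  qed
  then have "(UNIV :: 'v set) = (\<Union>n. last ` paths_from E x n)" by blast
  moreover have "countable (\<Union>n. last ` paths_from E x n)"
    using finite_paths_from[OF assms] by (intro countable_UN) (auto intro: countable_finite)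
  ultimately show ?thesis by simp
qed

section \<open>Stationary configurations and rising paths\<close>

definition median3 :: "real \<Rightarrow> real \<Rightarrow> real \<Rightarrow> real" where
  "median3 a b c = max (min a b) (min (max a b) c)"

lemma median_triple: "median {#a, b, c#} = median3 a b c"
proof -
  have "sorted_list_of_multiset {#a, b, c#} = insort a (insort b [c])"
    by simp
  moreover have "size {#a, b, c#} div 2 = 1" by simp
  ultimately show ?thesis by (auto simp: median_def median3_def min_def max_def simp del: sorted_list_of_multiset_insert)
qed

text \<open>
  The energy inequality behind convergence: replacing \<open>u\<close> by the median lowers the total distance to
  \<open>a\<close>, \<open>b\<close>, \<open>c\<close> by at least the distance moved.
\<close>
lemma median3_contraction:
  "\<bar>median3 a b c - a\<bar> + \<bar>median3 a b c - b\<bar> + \<bar>median3 a b c - c\<bar> + \<bar>median3 a b c - u\<bar>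
     \<le> \<bar>u - a\<bar> + \<bar>u - b\<bar> + \<bar>u - c\<bar>"
  unfolding median3_def by (smt (verit))

lemma neighbors_triple:
  assumes "regular_tree 3 E"
  obtains a b c where "neighbors E x = {a, b, c}" "a \<noteq> b" "a \<noteq> c" "b \<noteq> c"
proof -
  have "card (neighbors E x) = 3" using assms by (simp add: regular_tree_def)
  then show ?thesis using that by (auto simp: card_3_iff)
qed

lemma median_neighbors_triple:
  assumes "neighbors E x = {a, b, c}" "a \<noteq> b" "a \<noteq> c" "b \<noteq> c"
  shows "median (image_mset f (mset_set (neighbors E x))) = median3 (f a) (f b) (f c)"
  using assms by (simp add: median_triple)

definition stationary :: "'v set set \<Rightarrow> ('v \<Rightarrow> real) \<Rightarrow> bool" where
  "stationary E V \<longleftrightarrow> (\<forall>x. V x = median (image_mset V (mset_set (neighbors E x))))"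

text \<open>If two of three numbers exceed \<open>V x\<close>, so does their median.\<close>
lemma stationary_upper_unique:
  assumes tr: "regular_tree 3 E" and V: "stationary E V"
    and y: "{x, y} \<in> E" "V x < V y" and z: "{x, z} \<in> E" "V x < V z"
  shows "y = z"
proof (rule ccontr)
  assume "y \<noteq> z"
  obtain a b c where n: "neighbors E x = {a, b, c}" "a \<noteq> b" "a \<noteq> c" "b \<noteq> c"
    using neighbors_triple[OF tr] by metis
  have "V x = median3 (V a) (V b) (V c)"
    using V median_neighbors_triple[OF n] by (metis stationary_def)
  moreover have "y \<in> {a, b, c}" "z \<in> {a, b, c}" using y z n(1) by (auto simp: neighbors_def)
  ultimately show False using \<open>y \<noteq> z\<close> y(2) z(2) by (auto simp: median3_def)
qed

lemma median3_reflect: "median3 (1 - a) (1 - b) (1 - c) = 1 - median3 a b c"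
  by (auto simp: median3_def min_def max_def)

text \<open>
  The reflection \<open>V \<mapsto> 1 - V\<close> preserves stationarity and the unit interval, and turns statements about
  larger neighbors and rising paths into statements about smaller neighbors and falling paths.
\<close>
lemma stationary_reflect:
  assumes tr: "regular_tree 3 E" and V: "stationary E V"
  shows "stationary E (\<lambda>x. 1 - V x)"
  unfolding stationary_def
proof
  fix x
  obtain a b c where n: "neighbors E x = {a, b, c}" "a \<noteq> b" "a \<noteq> c" "b \<noteq> c"
    using neighbors_triple[OF tr] by metis
  show "1 - V x = median (image_mset (\<lambda>x. 1 - V x) (mset_set (neighbors E x)))"
    using V by (simp add: median_neighbors_triple[OF n] median3_reflect stationary_def)
qed

definition rising :: "'v set set \<Rightarrow> ('v \<Rightarrow> real) \<Rightarrow> 'v list \<Rightarrow> bool" where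
  "rising E V p \<longleftrightarrow> p \<noteq> [] \<and> successively (\<lambda>x y. {x, y} \<in> E \<and> V x < V y) p"

lemma rising_Cons:
  "rising E V (x # p) \<longleftrightarrow> p = [] \<or> {x, hd p} \<in> E \<and> V x < V (hd p) \<and> rising E V p"
  by (cases p) (auto simp: rising_def)

lemma rising_append:
  "p \<noteq> [] \<Longrightarrow> q \<noteq> [] \<Longrightarrow> rising E V (p @ q) \<longleftrightarrow>
     rising E V p \<and> rising E V q \<and> {last p, hd q} \<in> E \<and> V (last p) < V (hd q)"
  by (auto simp: rising_def successively_append_iff)

lemma rising_sorted: "rising E V p \<Longrightarrow> sorted_wrt (\<lambda>x y. V x < V y) p"
  unfolding rising_def
  by (subst successively_conv_sorted_wrt[symmetric])
    (auto simp: transp_def elim: successively_mono)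

lemma rising_is_path: "rising E V p \<Longrightarrow> is_path E p"
proof -
  assume r: "rising E V p"
  have "distinct p" using rising_sorted[OF r] by (induction p) auto
  with r show ?thesis by (auto simp: rising_def is_path_def elim: successively_mono)
qed

lemma rising_rev_reflect: "rising E (\<lambda>x. 1 - V x) (rev p) \<longleftrightarrow> rising E V p"
  by (auto simp: rising_def insert_commute)

lemma stationary_lower_unique:
  assumes tr: "regular_tree 3 E" and V: "stationary E V"
    and y: "{x, y} \<in> E" "V y < V x" and z: "{x, z} \<in> E" "V z < V x"
  shows "y = z"
  using stationary_upper_unique[OF tr stationary_reflect[OF tr V]] y z by auto

lemma longest_list:
  assumes "P p0" "\<And>p. P p \<Longrightarrow> length p \<le> n"
  obtains p where "P p" "\<And>q. P q \<Longrightarrow> length q \<le> length p"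
  using ex_has_greatest_nat[of P p0 length "Suc n"] assms by (metis le_imp_less_Suc)

text \<open>
  The longest rising path that ends at \<open>x\<close>, followed by the longest one that starts at \<open>x\<close>, cannot be
  extended at either end; as each vertex has only one larger and one smaller neighbor, no disagreement
  edge leaves it.
\<close>
lemma component_is_rising_path:
  assumes tr: "regular_tree 3 E" and V: "stationary E V"
    and up: "\<And>x. \<exists>n. \<forall>p. rising E V p \<and> hd p = x \<longrightarrow> length p \<le> n"
    and down: "\<And>x. \<exists>n. \<forall>p. rising E V p \<and> last p = x \<longrightarrow> length p \<le> n"
    and D: "D = {{x, y} | x y. {x, y} \<in> E \<and> V x \<noteq> V y}"
    and C: "C \<in> graph_components D"
  shows "\<exists>p. is_path E p \<and> C = set p \<and> {e \<in> D. e \<subseteq> C} = path_edges p"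
proof -
  obtain x where Cx: "C = {y. (x, y) \<in> {(a, b). {a, b} \<in> D}\<^sup>*}"
    using C by (auto simp: graph_components_def)
  have D_iff: "{a, b} \<in> D \<longleftrightarrow> {a, b} \<in> E \<and> V a \<noteq> V b" for a b
    unfolding D by (auto simp: doubleton_eq_iff insert_commute)
  have r1: "rising E V [y]" for y by (simp add: rising_def)
  obtain n where n: "\<forall>p. rising E V p \<and> hd p = x \<longrightarrow> length p \<le> n" using up by blast
  obtain p where p': "rising E V p \<and> hd p = x"
    "\<And>q. rising E V q \<and> hd q = x \<Longrightarrow> length q \<le> length p"
    by (rule longest_list[of "\<lambda>q. rising E V q \<and> hd q = x" "[x]" n]) (use r1 n in auto)
  then have p: "rising E V p" "hd p = x" by auto
  obtain n where n: "\<forall>p. rising E V p \<and> last p = x \<longrightarrow> length p \<le> n" using down by blast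
  obtain q where q': "rising E V q \<and> last q = x"
    "\<And>q'. rising E V q' \<and> last q' = x \<Longrightarrow> length q' \<le> length q"
    by (rule longest_list[of "\<lambda>q. rising E V q \<and> last q = x" "[x]" n]) (use r1 n in auto)
  then have q: "rising E V q" "last q = x" by auto
  have ne: "p \<noteq> []" "q \<noteq> []" using p q by (auto simp: rising_def)
  define r where "r = q @ tl p"
  have r: "rising E V r"
  proof (cases "tl p = []")
    case False
    have "p = x # tl p" using p(2) ne by (cases p) auto
    then have "rising E V (x # tl p)" using p(1) by simp
    then show ?thesis using q ne False by (simp add: rising_Cons r_def rising_append)
  qed (simp add: r_def q)
  have xr: "x \<in> set r" using q ne by (auto simp: r_def)
  have rne: "r \<noteq> []" using r by (simp add: rising_def)
  have top: "\<not> V (last r) < V y" if "{last r, y} \<in> E" for y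
  proof
    assume y: "V (last r) < V y"
    have l: "last p = last r" using ne p(2) q(2) by (cases p) (auto simp: r_def)
    have "rising E V (p @ [y])" using p ne that y l by (simp add: rising_append r1)
    then show False using p'(2)[of "p @ [y]"] p(2) ne by simp
  qed
  have bot: "\<not> V y < V (hd r)" if "{hd r, y} \<in> E" for y
  proof
    assume y: "V y < V (hd r)"
    have "rising E V (y # q)" using q ne that y by (simp add: rising_Cons r_def insert_commute)
    then show False using q'(2)[of "y # q"] q(2) ne by simp
  qed
  have nxt: "{r ! i, r ! Suc i} \<in> E \<and> V (r ! i) < V (r ! Suc i)" if "Suc i < length r" for i
    using r that by (auto simp: rising_def successively_conv_nth)
  have upper: "Suc i < length r \<and> y = r ! Suc i"
    if "i < length r" "{r ! i, y} \<in> E" "V (r ! i) < V y" for i y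
  proof -
    have "Suc i < length r"
    proof (rule ccontr)
      assume "\<not> Suc i < length r"
      then have "i = length r - 1" using that(1) by simp
      then have "r ! i = last r" using rne by (simp add: last_conv_nth)
      then show False using top that by simp
    qed
    then show ?thesis using stationary_upper_unique[OF tr V] nxt that by metis
  qed
  have lower: "\<exists>j. i = Suc j \<and> y = r ! j"
    if "i < length r" "{r ! i, y} \<in> E" "V y < V (r ! i)" for i y
  proof (cases i)
    case 0
    then show ?thesis using bot that rne by (simp add: hd_conv_nth)
  next
    case (Suc j)
    then show ?thesis using stationary_lower_unique[OF tr V, of "r ! i" y "r ! j"] nxt[of j] that
      by (auto simp: insert_commute)
  qed
  have edge: "\<exists>i. Suc i < length r \<and> {a, b} = {r ! i, r ! Suc i}" if ab: "a \<in> set r" "{a, b} \<in> D" for a b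
  proof -
    obtain i where i: "i < length r" "a = r ! i" using ab(1) by (auto simp: in_set_conv_nth)
    from that(2) have "{a, b} \<in> E" "V a < V b \<or> V b < V a" by (auto simp: D_iff)
    then consider "Suc i < length r" "b = r ! Suc i" | j where "i = Suc j" "b = r ! j"
      using upper[OF i(1), of b] lower[OF i(1), of b] i(2) by auto
    then show ?thesis using i by cases (auto simp: insert_commute)
  qed
  have "C \<subseteq> set r"
  proof
    fix y assume "y \<in> C"
    then have "(x, y) \<in> {(a, b). {a, b} \<in> D}\<^sup>*" using Cx by simp
    then show "y \<in> set r"
    proof (induction rule: rtrancl_induct)
      case (step a b)
      then obtain i where "Suc i < length r" "{a, b} = {r ! i, r ! Suc i}" using edge by blast
      then show ?case by (auto simp: doubleton_eq_iff)
    qed (rule xr)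
  qed
  moreover have "set r \<subseteq> C"
  proof -
    let ?R = "{(a, b). {a, b} \<in> D}"
    have sym: "sym (?R\<^sup>*)" by (intro sym_rtrancl) (auto simp: sym_def insert_commute)
    have all: "(hd r, r ! i) \<in> ?R\<^sup>*" if "i < length r" for i
      using that
    proof (induction i)
      case 0 then show ?case by (simp add: hd_conv_nth rne)
    next
      case (Suc i)
      then have "(r ! i, r ! Suc i) \<in> ?R" using nxt[of i] by (auto simp: D_iff)
      then show ?case using Suc by (meson Suc_lessD rtrancl.rtrancl_into_rtrancl)
    qed
    have h: "(hd r, y) \<in> ?R\<^sup>*" if "y \<in> set r" for y using all that by (auto simp: in_set_conv_nth)
    have "(x, hd r) \<in> ?R\<^sup>*" using h[OF xr] sym by (meson symD)
    then show ?thesis using h Cx by (auto intro: rtrancl_trans)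
  qed
  ultimately have "C = set r" by blast
  moreover have "{e \<in> D. e \<subseteq> C} = path_edges r"
  proof
    show "{e \<in> D. e \<subseteq> C} \<subseteq> path_edges r"
    proof
      fix e assume e: "e \<in> {e \<in> D. e \<subseteq> C}"
      then obtain a b where ab: "e = {a, b}" unfolding D by blast
      then show "e \<in> path_edges r" using edge[of a b] e \<open>C = set r\<close> by (auto simp: path_edges_def)
    qed
    show "path_edges r \<subseteq> {e \<in> D. e \<subseteq> C}"
      using nxt \<open>C = set r\<close> by (force simp: path_edges_def D_iff)
  qed
  ultimately show ?thesis using rising_is_path[OF r] by blast
qed

section \<open>The synchronous dynamics and the invariance of its law\<close>

text \<open>
  Discrete-time median dynamics with initial values \<open>a\<close>: at step \<open>k\<close> exactly the vertices \<open>x\<close> with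
  \<open>r x k\<close> are updated, all at once.
\<close>
primrec dyn :: "'v set set \<Rightarrow> ('v \<Rightarrow> real) \<Rightarrow> ('v \<Rightarrow> nat \<Rightarrow> bool) \<Rightarrow> nat \<Rightarrow> 'v \<Rightarrow> real" where
  "dyn E a r 0 = a"
| "dyn E a r (Suc k) = (\<lambda>x. if r x k
     then median (image_mset (dyn E a r k) (mset_set (neighbors E x))) else dyn E a r k x)"

lemma dyn_automorphism:
  assumes "automorphism E \<phi>"
  shows "dyn E (\<lambda>x. a (\<phi> x)) (\<lambda>x. r (\<phi> x)) k x = dyn E a r k (\<phi> x)"
proof (induction k arbitrary: x)
  case (Suc k)
  have inj: "inj_on \<phi> A" for A
    using assms by (auto simp: automorphism_def bij_def intro: inj_on_subset)
  have "neighbors E (\<phi> x) = \<phi> ` neighbors E x" using assms by (simp add: automorphism_def)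
  then have "mset_set (neighbors E (\<phi> x)) = image_mset \<phi> (mset_set (neighbors E x))"
    using image_mset_mset_set[OF inj] by metis
  moreover have "dyn E (\<lambda>x. a (\<phi> x)) (\<lambda>x. r (\<phi> x)) k = (\<lambda>x. dyn E a r k (\<phi> x))"
    using Suc.IH by (rule ext)
  ultimately show ?case by (simp add: multiset.map_comp o_def)
qed simp

lemma measurable_nat_less:
  assumes [measurable]: "f \<in> measurable M (count_space UNIV)" "g \<in> measurable M (count_space UNIV)"
  shows "Measurable.pred M (\<lambda>\<omega>. (f \<omega> :: nat) < g \<omega>)"
  by (rule measurable_compose_countable[of "\<lambda>i \<omega>. i < g \<omega>" _ _ f])
    (auto intro: measurable_compose[OF assms(2) measurable_count_space])

lemma measurable_nat_diff:
  assumes [measurable]: "f \<in> measurable M (count_space UNIV)" "g \<in> measurable M (count_space UNIV)"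
  shows "(\<lambda>\<omega>. (f \<omega> :: nat) - g \<omega>) \<in> measurable M (count_space UNIV)"
  by (rule measurable_compose_countable[of "\<lambda>i \<omega>. i - g \<omega>" _ _ f])
    (auto intro: measurable_compose[OF assms(2) measurable_count_space])

abbreviation (input) initial_space :: "('v \<Rightarrow> real) measure" where
  "initial_space \<equiv> PiM UNIV (\<lambda>_. borel)"

abbreviation (input) flag_space :: "('v \<Rightarrow> nat \<Rightarrow> bool) measure" where
  "flag_space \<equiv> PiM UNIV (\<lambda>_. PiM UNIV (\<lambda>_. count_space UNIV))"

lemma measurable_dyn:
  fixes E :: "'v set set"
  assumes tr: "regular_tree 3 E"
  shows "(\<lambda>(a, r). dyn E a r k x) \<in>
    borel_measurable (initial_space \<Otimes>\<^sub>M flag_space)"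
proof (induction k arbitrary: x)
  case 0
  show ?case by (simp add: case_prod_beta) measurable
next
  case (Suc k)
  obtain a b c where n: "neighbors E x = {a, b, c}" "a \<noteq> b" "a \<noteq> c" "b \<noteq> c"
    using neighbors_triple[OF tr] by metis
  have [measurable]: "(\<lambda>p. dyn E (fst p) (snd p) k y) \<in> borel_measurable (initial_space \<Otimes>\<^sub>M flag_space)" for y
    using Suc.IH[of y] by (simp add: case_prod_beta)
  have [measurable]: "(\<lambda>p. snd p x k) \<in> measurable ((initial_space :: ('v \<Rightarrow> real) measure) \<Otimes>\<^sub>M flag_space) (count_space UNIV)"
    by (rule measurable_compose[where f = "\<lambda>p. snd p x" and N = "PiM UNIV (\<lambda>_. count_space UNIV)"]) auto
  show ?case
    unfolding dyn.simps median_neighbors_triple[OF n] case_prod_beta median3_def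
    by measurable
qed

lemma PiM_UNIV_reindex:
  assumes "bij \<phi>" "prob_space \<mu>"
  shows "distr (PiM UNIV (\<lambda>_. \<mu>)) (PiM UNIV (\<lambda>_. \<mu>)) (\<lambda>f x. f (\<phi> x)) = PiM UNIV (\<lambda>_. \<mu>)"
  using distr_PiM_reindex[of UNIV "\<lambda>_. \<mu>" \<phi> UNIV] assms by (auto simp: bij_def restrict_UNIV)

locale median_tree = median_process M E N U
  for M :: "'w measure"
    and E :: "'v set set"
    and N :: "'v \<Rightarrow> real \<Rightarrow> 'w \<Rightarrow> nat"
    and U :: "'v \<Rightarrow> real \<Rightarrow> 'w \<Rightarrow> real" +
  assumes tree: "regular_tree 3 E"
begin

text \<open>
  Level \<open>m\<close> refers to the time cells from \<open>k / 2 ^ m\<close> to \<open>Suc k / 2 ^ m\<close>; \<open>rang m \<omega> x k\<close> says that the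
  clock of \<open>x\<close> rings in cell \<open>k\<close>, the right end included.
\<close>
definition rang :: "nat \<Rightarrow> 'w \<Rightarrow> 'v \<Rightarrow> nat \<Rightarrow> bool" where
  "rang m \<omega> x k \<longleftrightarrow> N x (real k / 2 ^ m) \<omega> < N x (real (Suc k) / 2 ^ m) \<omega>"

definition initial :: "'w \<Rightarrow> 'v \<Rightarrow> real" where
  "initial \<omega> x = U x 0 \<omega>"

lemma measurable_clock: "0 \<le> t \<Longrightarrow> N x t \<in> measurable M (count_space UNIV)"
  using clocks_poisson[of x] by (simp add: poisson_process_def)

lemma clock_increments:
  "0 \<le> s \<Longrightarrow> s < t \<Longrightarrow> distr M (count_space UNIV) (\<lambda>\<omega>. N x t \<omega> - N x s \<omega>) =
     measure_pmf (poisson_pmf (1 * (t - s)))"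
  using clocks_poisson[of x] unfolding poisson_process_def by fast

lemma clock_indep_increments:
  "0 \<le> t 0 \<Longrightarrow> mono t \<Longrightarrow> indep_vars (\<lambda>_. count_space UNIV)
     (\<lambda>i \<omega>. N x (t (Suc i)) \<omega> - N x (t i) \<omega>) {..<n}" for t :: "nat \<Rightarrow> real"
  using clocks_poisson[of x] unfolding poisson_process_def by fast

lemma measurable_rang [measurable]: "(\<lambda>\<omega>. rang m \<omega> x k) \<in> measurable M (count_space UNIV)"
proof -
  show ?thesis unfolding rang_def by (intro measurable_nat_less measurable_clock) auto
qed

lemma measurable_rang_sequence: 
  "(\<lambda>\<omega> k. rang m \<omega> x k) \<in> measurable M (PiM UNIV (\<lambda>_. count_space UNIV))"
  by (rule measurable_PiM_single') auto

lemma measurable_flags: "rang m \<in> measurable M flag_space"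
  using measurable_PiM_single'[of UNIV "\<lambda>x \<omega>. rang m \<omega> x" M "\<lambda>_. PiM UNIV (\<lambda>_. count_space UNIV)"]
    measurable_rang_sequence by (simp add: space_PiM)

lemma measurable_initial: "initial \<in> measurable M initial_space"
proof -
  have "U x 0 \<in> borel_measurable M" for x using initial_indep by (simp add: indep_vars_def)
  then show ?thesis 
    using measurable_PiM_single'[of UNIV "\<lambda>x \<omega>. initial \<omega> x" M "\<lambda>_. borel"] by (simp add: initial_def[abs_def])
qed

text \<open>
  For fixed \<open>m\<close> the flags \<open>rang m \<omega> x k\<close> are i.i.d. in both \<open>x\<close> and \<open>k\<close>: over \<open>k\<close> because the
  increments of a Poisson process are independent, over \<open>x\<close> because the clocks are. This is their
  common law.
\<close>
definition flag_law :: "nat \<Rightarrow> bool measure" where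
  "flag_law m = distr (measure_pmf (poisson_pmf (1 / 2 ^ m))) (count_space UNIV) (\<lambda>n. 0 < n)"

lemma distr_rang: "distr M (count_space UNIV) (\<lambda>\<omega>. rang m \<omega> x k) = flag_law m"
proof -
  let ?s = "real k / 2 ^ m" and ?t = "real (Suc k) / 2 ^ m"
  have st: "0 \<le> ?s" "?s < ?t" "?t - ?s = 1 / 2 ^ m" by (auto simp: divide_simps)
  have [measurable]: "N x ?s \<in> measurable M (count_space UNIV)" "N x ?t \<in> measurable M (count_space UNIV)"
    by (rule measurable_clock; simp)+
  have eq: "distr M (count_space UNIV) (\<lambda>\<omega>. N x ?t \<omega> - N x ?s \<omega>) = measure_pmf (poisson_pmf (1 / 2 ^ m))"
  proof -
    have "distr M (count_space UNIV) (\<lambda>\<omega>. N x ?t \<omega> - N x ?s \<omega>) = measure_pmf (poisson_pmf (1 * (?t - ?s)))"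
      using clock_increments st(1,2) by blast
    then show ?thesis unfolding st(3) by simp
  qed
  have "flag_law m = distr M (count_space UNIV) ((\<lambda>n. 0 < n) \<circ> (\<lambda>\<omega>. N x ?t \<omega> - N x ?s \<omega>))"
    unfolding flag_law_def eq[symmetric]
    by (rule distr_distr) (auto intro!: measurable_nat_diff measurable_clock)
  also have "(\<lambda>n. 0 < n) \<circ> (\<lambda>\<omega>. N x ?t \<omega> - N x ?s \<omega>) = (\<lambda>\<omega>. rang m \<omega> x k)"
    unfolding rang_def comp_def by (simp only: zero_less_diff)
  finally show ?thesis by simp
qed

lemma prob_not_rang: "prob {\<omega> \<in> space M. \<not> rang m \<omega> x k} = exp (- 1 / 2 ^ m)"
proof -
  have "prob {\<omega> \<in> space M. \<not> rang m \<omega> x k} = measure (distr M (count_space UNIV) (\<lambda>\<omega>. rang m \<omega> x k)) {False}"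
    by (subst measure_distr) (auto intro!: arg_cong[where f = prob])
  also have "\<dots> = measure (measure_pmf (poisson_pmf (1 / 2 ^ m))) {0}"
    unfolding distr_rang flag_law_def by (subst measure_distr) (auto intro!: arg_cong[where f = "measure _"])
  also have "\<dots> = exp (- 1 / 2 ^ m)" by (simp add: measure_pmf_single)
  finally show ?thesis .
qed

lemma prob_rang: "prob {\<omega> \<in> space M. rang m \<omega> x k} \<le> 1 / 2 ^ m"
proof -
  have "{\<omega> \<in> space M. rang m \<omega> x k} = space M - {\<omega> \<in> space M. \<not> rang m \<omega> x k}" by auto
  then have "prob {\<omega> \<in> space M. rang m \<omega> x k} = 1 - exp (- 1 / 2 ^ m)"
    using prob_compl[of "{\<omega> \<in> space M. \<not> rang m \<omega> x k}"] prob_not_rang by simp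
  then show ?thesis using exp_ge_add_one_self[of "- 1 / 2 ^ m"] by simp
qed

lemma indep_rang_times: "indep_vars (\<lambda>_. count_space UNIV) (\<lambda>k \<omega>. rang m \<omega> x k) UNIV"
proof -
  let ?t = "\<lambda>k. real k / 2 ^ m"
  have mono: "mono ?t" by (auto simp: mono_def divide_right_mono)
  have "indep_vars (\<lambda>_. count_space UNIV) (\<lambda>k \<omega>. rang m \<omega> x k) {..<n}" for n
  proof -
    have "indep_vars (\<lambda>_. count_space UNIV) (\<lambda>i \<omega>. N x (?t (Suc i)) \<omega> - N x (?t i) \<omega>) {..<n}"
    proof -
      have "0 \<le> ?t 0 \<and> mono ?t" using mono by simp
      then show ?thesis by (intro clock_indep_increments) auto
    qed
    then have "indep_vars (\<lambda>_. count_space UNIV) (\<lambda>i \<omega>. 0 < N x (?t (Suc i)) \<omega> - N x (?t i) \<omega>) {..<n}"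
      by (rule indep_vars_compose2) auto
    then show ?thesis by (simp add: rang_def)
  qed
  then have fin: "indep_vars (\<lambda>_. count_space UNIV) (\<lambda>k \<omega>. rang m \<omega> x k) J" if J: "finite J" for J
  proof -
    obtain n where "J \<subseteq> {..<n}" using J by (auto simp: finite_nat_iff_bounded)
    then show ?thesis by (rule indep_vars_subset[rotated]) fact
  qed
  show ?thesis
    unfolding indep_vars_def
  proof (subst indep_sets_finite_index_sets, intro conjI ballI allI impI)
    fix J :: "nat set" assume "finite J"
    from fin[OF this] show "indep_sets (\<lambda>i. sigma_sets (space M)
        {(\<lambda>\<omega>. rang m \<omega> x i) -` A \<inter> space M |A. A \<in> sets (count_space UNIV)}) J"
      unfolding indep_vars_def by (rule conjunct2)
  qed simp
qed

lemma distr_rang_sequence: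
  "distr M (PiM UNIV (\<lambda>_. count_space UNIV)) (\<lambda>\<omega> k. rang m \<omega> x k) = PiM UNIV (\<lambda>_. flag_law m)"
  using indep_rang_times[of m x]
  by (subst (asm) indep_vars_iff_distr_eq_PiM) (auto simp: distr_rang restrict_UNIV)

lemma indep_rang_vertices:
  "indep_vars (\<lambda>_. PiM UNIV (\<lambda>_. count_space UNIV)) (\<lambda>x \<omega>. rang m \<omega> x) UNIV"
proof -
  let ?f = "\<lambda>n k. (n (real k / 2 ^ m) :: nat) < n (real (Suc k) / 2 ^ m)"
  have "?f \<in> measurable (PiM {0..} (\<lambda>_. count_space UNIV)) (PiM UNIV (\<lambda>_. count_space UNIV))"
  proof (rule measurable_PiM_single')
    fix k :: nat
    show "(\<lambda>n. ?f n k) \<in> measurable (PiM {0..} (\<lambda>_. count_space UNIV)) (count_space UNIV)"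
      by (intro measurable_nat_less measurable_component_singleton) auto
  qed auto
  from indep_vars_compose2[OF clocks_indep this] show ?thesis
    by (simp add: rang_def[abs_def])
qed

lemma distr_flags: "distr M flag_space (rang m) = PiM UNIV (\<lambda>_. PiM UNIV (\<lambda>_. flag_law m))"
  using indep_rang_vertices[of m] measurable_rang_sequence
  by (subst (asm) indep_vars_iff_distr_eq_PiM) (auto simp: distr_rang_sequence restrict_UNIV)

lemma distr_initial: "distr M initial_space initial = PiM UNIV (\<lambda>_. uniform_measure lborel {0..1})"
proof -
  have "U x 0 \<in> borel_measurable M" for x using initial_indep by (simp add: indep_vars_def)
  then show ?thesis using initial_indep initial_uniform
    by (subst (asm) indep_vars_iff_distr_eq_PiM) (auto simp: restrict_UNIV initial_def[abs_def])
qed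

text \<open>
  The flags are a measurable function of the clocks, which are independent of the initial values.
\<close>
lemma distr_inputs:
  "distr M (initial_space \<Otimes>\<^sub>M flag_space) (\<lambda>\<omega>. (initial \<omega>, rang m \<omega>)) =
     distr M initial_space initial \<Otimes>\<^sub>M distr M flag_space (rang m)"
proof (rule sym, rule pair_measure_eqI)
  note [measurable] = measurable_initial measurable_flags
  interpret I: prob_space "distr M initial_space initial" by (rule prob_space_distr) simp
  interpret F: prob_space "distr M flag_space (rang m)" by (rule prob_space_distr) simp
  show "sigma_finite_measure (distr M initial_space initial)" by unfold_locales
  show "sigma_finite_measure (distr M flag_space (rang m))" by unfold_locales
  show "sets (distr M initial_space initial \<Otimes>\<^sub>M distr M flag_space (rang m)) =
    sets (distr M (initial_space \<Otimes>\<^sub>M flag_space) (\<lambda>\<omega>. (initial \<omega>, rang m \<omega>)))"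
    by (simp cong: sets_pair_measure_cong)
  fix A B assume "A \<in> sets (distr M initial_space initial)" "B \<in> sets (distr M flag_space (rang m))"
  then have [measurable]: "A \<in> sets initial_space" "B \<in> sets flag_space" by auto
  let ?g = "\<lambda>n x k. (n x (real k / 2 ^ m) :: nat) < n x (real (Suc k) / 2 ^ m)"
  let ?C = "PiM UNIV (\<lambda>_::'v. PiM {0..} (\<lambda>_::real. count_space (UNIV :: nat set)))"
  have g: "?g \<in> measurable ?C flag_space"
  proof (intro measurable_PiM_single')
    fix x :: 'v and k :: nat
    have comp: "(\<lambda>n. n x t) \<in> measurable ?C (count_space UNIV)" if "0 \<le> t" for t
    proof (rule measurable_compose[where f = "\<lambda>n. n x" and g = "\<lambda>n. n t"])
      show "(\<lambda>n. n x) \<in> measurable ?C (PiM {0..} (\<lambda>_. count_space UNIV))"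
        by (rule measurable_component_singleton) simp
      show "(\<lambda>n. n t) \<in> measurable (PiM {0..} (\<lambda>_. count_space UNIV)) (count_space UNIV)"
        using that by (intro measurable_component_singleton) simp
    qed
    show "(\<lambda>n. ?g n x k) \<in> measurable ?C (count_space UNIV)"
      by (intro measurable_nat_less comp) auto
  qed (auto simp: space_PiM)
  let ?N = "\<lambda>\<omega> x. \<lambda>t\<in>{0..}. N x t \<omega>"
  have "?N \<omega> \<in> space ?C" for \<omega> by (simp add: space_PiM PiE_def extensional_def)
  moreover have "?g (?N \<omega>) = rang m \<omega>" for \<omega> by (simp add: rang_def fun_eq_iff)
  ultimately have eqB: "rang m -` B \<inter> space M = ?N -` (?g -` B \<inter> space ?C) \<inter> space M"
    by (simp add: set_eq_iff)
  have "?g -` B \<inter> space ?C \<in> sets ?C" using g by (rule measurable_sets) simp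
  then have "rang m -` B \<inter> space M \<in> sets (vimage_algebra (space M) ?N ?C)"
    unfolding eqB by (rule in_vimage_algebra)
  moreover have "initial -` A \<inter> space M \<in> sets (vimage_algebra (space M) (\<lambda>\<omega> x. U x 0 \<omega>) initial_space)"
    unfolding initial_def[abs_def] by (rule in_vimage_algebra) simp
  ultimately have "prob ((initial -` A \<inter> space M) \<inter> (rang m -` B \<inter> space M)) =
      prob (initial -` A \<inter> space M) * prob (rang m -` B \<inter> space M)"
    using indep_setD[OF initial_clocks_indep] by simp
  moreover have "(\<lambda>\<omega>. (initial \<omega>, rang m \<omega>)) -` (A \<times> B) \<inter> space M =
      (initial -` A \<inter> space M) \<inter> (rang m -` B \<inter> space M)" by auto
  ultimately show "emeasure (distr M initial_space initial) A * emeasure (distr M flag_space (rang m)) B =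
      emeasure (distr M (initial_space \<Otimes>\<^sub>M flag_space) (\<lambda>\<omega>. (initial \<omega>, rang m \<omega>))) (A \<times> B)"
    by (simp add: emeasure_distr emeasure_eq_measure ennreal_mult)
qed

text \<open>
  The inputs of the synchronous dynamics are i.i.d. over the vertices, so relabelling the
  vertices does not change their law. All invariance used below comes from here.
\<close>
lemma expectation_automorphism:
  fixes H :: "('v \<Rightarrow> real) \<times> ('v \<Rightarrow> nat \<Rightarrow> bool) \<Rightarrow> real"
  assumes "automorphism E \<phi>" 
    and [measurable]: "H \<in> borel_measurable (initial_space \<Otimes>\<^sub>M flag_space)"
  shows "expectation (\<lambda>\<omega>. H (\<lambda>x. initial \<omega> (\<phi> x), \<lambda>x. rang m \<omega> (\<phi> x))) =
         expectation (\<lambda>\<omega>. H (initial \<omega>, rang m \<omega>))"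
proof -
  note [measurable] = measurable_initial measurable_flags
  have bij: "bij \<phi>" using assms(1) by (simp add: automorphism_def)
  let ?I = "distr M initial_space initial" and ?F = "distr M flag_space (rang m)"
  interpret I: prob_space ?I by (rule prob_space_distr) simp
  interpret F: prob_space ?F by (rule prob_space_distr) simp
  have [measurable]: "(\<lambda>f x. f (\<phi> x)) \<in> measurable initial_space (initial_space :: ('v \<Rightarrow> real) measure)"
    by (rule measurable_PiM_single') (auto)
  have [measurable]: "(\<lambda>f x. f (\<phi> x)) \<in> measurable flag_space (flag_space :: ('v \<Rightarrow> nat \<Rightarrow> bool) measure)"
    by (rule measurable_PiM_single') (auto simp: space_PiM)
  have pu: "prob_space (uniform_measure lborel {0..1::real})" by (rule prob_space_uniform_measure) auto
  have pf: "prob_space (PiM UNIV (\<lambda>_::nat. flag_law m))"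
    unfolding flag_law_def by (intro prob_space_PiM prob_space.prob_space_distr prob_space_measure_pmf) auto
  have dI: "distr ?I ?I (\<lambda>f x. f (\<phi> x)) = ?I"
    using PiM_UNIV_reindex[OF bij pu] unfolding distr_initial .
  have dF: "distr ?F ?F (\<lambda>f x. f (\<phi> x)) = ?F"
    using PiM_UNIV_reindex[OF bij pf] unfolding distr_flags .
  let ?P = "distr M (initial_space \<Otimes>\<^sub>M flag_space) (\<lambda>\<omega>. (initial \<omega>, rang m \<omega>))"
  let ?T = "\<lambda>(f, g). (\<lambda>x. f (\<phi> x), \<lambda>x. g (\<phi> x))"
  have "distr ?P (initial_space \<Otimes>\<^sub>M flag_space) ?T = distr (?I \<Otimes>\<^sub>M ?F) (?I \<Otimes>\<^sub>M ?F) ?T"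
    unfolding distr_inputs by (rule distr_cong) (auto cong: sets_pair_measure_cong)
  also have "\<dots> = distr ?I ?I (\<lambda>f x. f (\<phi> x)) \<Otimes>\<^sub>M distr ?F ?F (\<lambda>f x. f (\<phi> x))"
    by (rule pair_measure_distr[symmetric]) (auto simp: dF F.sigma_finite_measure_axioms)
  also have "\<dots> = ?P" unfolding dI dF distr_inputs ..
  finally have inv: "distr ?P (initial_space \<Otimes>\<^sub>M flag_space) ?T = ?P" .
  have "expectation (\<lambda>\<omega>. H (initial \<omega>, rang m \<omega>)) = integral\<^sup>L ?P H"
    by (rule integral_distr[symmetric]) auto
  also have "\<dots> = integral\<^sup>L (distr ?P (initial_space \<Otimes>\<^sub>M flag_space) ?T) H" unfolding inv ..
  also have "\<dots> = integral\<^sup>L ?P (\<lambda>p. H (?T p))"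
    by (rule integral_distr) auto
  also have "\<dots> = expectation (\<lambda>\<omega>. H (?T (initial \<omega>, rang m \<omega>)))"
    by (rule integral_distr) auto
  finally show ?thesis by simp
qed

end

section \<open>Pathwise comparison with the synchronous dynamics\<close>

definition counting_path :: "(real \<Rightarrow> nat) \<Rightarrow> bool" where
  "counting_path n \<longleftrightarrow> mono_on {0..} n \<and> (\<forall>t\<ge>0. continuous (at_right t) n)"

lemma counting_path_mono: "counting_path n \<Longrightarrow> 0 \<le> s \<Longrightarrow> s \<le> t \<Longrightarrow> n s \<le> n t"
  by (auto simp: counting_path_def mono_on_def)

lemma rings_increase: "t \<in> rings n \<Longrightarrow> 0 \<le> s \<Longrightarrow> s < t \<Longrightarrow> n s < n t"
  by (auto simp: rings_def)

lemma counting_path_right_constant: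
  assumes n: "counting_path n" and t: "0 \<le> t"
  shows "\<exists>e>t. \<forall>s. t < s \<and> s < e \<longrightarrow> n s = n t"
proof -
  have "(n \<longlongrightarrow> n t) (at_right t)"
    using n t by (auto simp: counting_path_def continuous_within)
  then have "eventually (\<lambda>s. n s = n t) (at_right t)"
    by (rule tendsto_discrete[THEN iffD1, rotated -1])
  then show ?thesis by (auto simp: eventually_at_right_field)
qed

text \<open>
  The infimum of the times at which the count exceeds \<open>n a\<close> is a jump time by right continuity.
\<close>
lemma ring_between:
  assumes n: "counting_path n" and ab: "0 \<le> a" "n a < n b" "a \<le> b"
  shows "\<exists>t\<in>rings n. a < t \<and> t \<le> b"
proof -
  \<comment> \<open>The first time at which the count exceeds its value at \<open>a\<close>.\<close>
  define S where "S = {s. a \<le> s \<and> s \<le> b \<and> n a < n s}"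
  define t where "t = Inf S"
  have S: "b \<in> S" "bdd_below S" using ab by (auto simp: S_def intro!: bdd_belowI[of _ a])
  have t: "a \<le> t" "t \<le> b" using S ab by (auto simp: t_def S_def intro!: cInf_greatest cInf_lower)
  obtain e where e: "e > t" "\<And>s. t < s \<Longrightarrow> s < e \<Longrightarrow> n s = n t"
    using counting_path_right_constant[OF n, of t] ab t by auto
  obtain s where s: "s \<in> S" "s < e" using cInf_lessD[of S e] S e by (auto simp: t_def)
  have "t \<le> s" using s S by (auto simp: t_def intro: cInf_lower)
  then have gt: "n a < n t" using s e by (cases "s = t") (auto simp: S_def)
  moreover have "n s' < n t" if "0 \<le> s'" "s' < t" for s'
  proof (cases "a \<le> s'")
    case True
    have "s' \<notin> S" using that S by (auto simp: t_def dest: cInf_lower)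
    then show ?thesis using True that t gt by (auto simp: S_def)
  next
    case False
    then show ?thesis using counting_path_mono[OF n, of s' a] that gt by simp
  qed
  moreover have "a < t" using gt t by (cases "a = t") auto
  ultimately have "t \<in> rings n" "a < t" using ab by (simp_all add: rings_def)
  then show ?thesis using t by blast
qed

text \<open>
  The rules that a realisation of the process obeys almost surely.
\<close>
definition median_path :: "'v set set \<Rightarrow> ('v \<Rightarrow> real \<Rightarrow> nat) \<Rightarrow> ('v \<Rightarrow> real \<Rightarrow> real) \<Rightarrow> bool" where
  "median_path E n u \<longleftrightarrow>
     (\<forall>x. counting_path (n x)) \<and>
     (\<forall>x s t. 0 \<le> s \<and> s \<le> t \<and> {s<..t} \<inter> rings (n x) = {} \<longrightarrow> u x t = u x s) \<and>
     (\<forall>x. \<forall>t\<in>rings (n x). u x t =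
        median (image_mset (\<lambda>y. left_limit (u y) t) (mset_set (neighbors E x))))"

context
  fixes E :: "'v set set" and n u
  assumes mp: "median_path E n u"
begin

lemma median_path_counting: "counting_path (n x)"
  using mp by (simp add: median_path_def)

lemma median_path_no_ring:
  "0 \<le> s \<Longrightarrow> s \<le> t \<Longrightarrow> {s<..t} \<inter> rings (n x) = {} \<Longrightarrow> u x t = u x s"
  using mp unfolding median_path_def by blast

lemma median_path_ring:
  "t \<in> rings (n x) \<Longrightarrow> u x t = median (image_mset (\<lambda>y. left_limit (u y) t) (mset_set (neighbors E x)))"
  using mp unfolding median_path_def by blast

lemma median_path_constant:
  assumes "0 \<le> a" "n x a = n x b" "a \<le> t" "t \<le> b"
  shows "u x t = u x a"
proof -
  note c = median_path_counting[of x]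
  have "{a<..t} \<inter> rings (n x) = {}"
  proof (rule ccontr)
    assume "{a<..t} \<inter> rings (n x) \<noteq> {}"
    then obtain s where "a < s" "s \<le> t" "s \<in> rings (n x)" by auto
    then have "n x a < n x s" "n x s \<le> n x b"
      using assms rings_increase[of s "n x" a] counting_path_mono[OF c, of s b] by auto
    then show False using assms by simp
  qed
  then show ?thesis using assms by (intro median_path_no_ring) auto
qed

text \<open>
  If the neighbors do not ring between \<open>a\<close> and \<open>b\<close>, all updates of \<open>x\<close> in between give the same value,
  the median of the values at time \<open>a\<close>. So one synchronous update has the same effect.
\<close>
lemma median_path_update:
  assumes ab: "0 \<le> a" "a \<le> b" and x: "n x a < n x b"
    and y: "\<And>y. y \<in> neighbors E x \<Longrightarrow> n y a = n y b"
  shows "u x b = median (image_mset (\<lambda>y. u y a) (mset_set (neighbors E x)))"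
proof -
  note c = median_path_counting[of x]
  have ex: "\<exists>t. t \<in> rings (n x) \<and> a < t \<and> t \<le> b" using ring_between[OF c ab(1) x ab(2)] by auto
  have bound: "\<forall>t. t \<in> rings (n x) \<and> a < t \<and> t \<le> b \<longrightarrow> n x t < Suc (n x b)"
    using counting_path_mono[OF c] ab by (auto simp: less_Suc_eq_le)
  \<comment> \<open>The last ring of \<open>x\<close> is the one with the highest count; the count is bounded up to time \<open>b\<close>.\<close>
  from ex bound obtain t where t: "t \<in> rings (n x)" "a < t" "t \<le> b"
    and max: "\<And>s. s \<in> rings (n x) \<and> a < s \<and> s \<le> b \<Longrightarrow> n x s \<le> n x t"
    using ex_has_greatest_nat[of "\<lambda>t. t \<in> rings (n x) \<and> a < t \<and> t \<le> b" _ "n x" "Suc (n x b)"] by blast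
  have "{t<..b} \<inter> rings (n x) = {}"
  proof (rule ccontr)
    assume "{t<..b} \<inter> rings (n x) \<noteq> {}"
    then obtain s where s: "t < s" "s \<le> b" "s \<in> rings (n x)" by auto
    then have "n x t < n x s" using rings_increase[of s "n x" t] t ab by auto
    then show False using max[of s] s t by auto
  qed
  then have "u x b = u x t" using t ab by (intro median_path_no_ring) auto
  also have "\<dots> = median (image_mset (\<lambda>y. left_limit (u y) t) (mset_set (neighbors E x)))"
    using t by (intro median_path_ring)
  also have "image_mset (\<lambda>y. left_limit (u y) t) (mset_set (neighbors E x)) =
      image_mset (\<lambda>y. u y a) (mset_set (neighbors E x))"
  proof (rule image_mset_cong)
    fix y assume "y \<in># mset_set (neighbors E x)"
    then have "y \<in> neighbors E x" by (cases "finite (neighbors E x)") auto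
    then have "n y a = n y b" by (rule y)
    then have eq: "u y s = u y a" if "a < s" "s < t" for s
      using median_path_constant[of a y b s] ab t that by simp
    have "eventually (\<lambda>s. u y a = u y s) (at_left t)"
      using eq t(2) by (auto simp: eventually_at_left_field intro!: exI[of _ a])
    then have "(u y \<longlongrightarrow> u y a) (at_left t)"
      by (rule tendsto_eventually[OF eventually_mono]) simp
    then show "left_limit (u y) t = u y a"
      unfolding left_limit_def by (intro tendsto_Lim) auto
  qed
  finally show ?thesis .
qed

end

definition cell_flag :: "('v \<Rightarrow> real \<Rightarrow> nat) \<Rightarrow> nat \<Rightarrow> 'v \<Rightarrow> nat \<Rightarrow> bool" where
  "cell_flag n m x k \<longleftrightarrow> n x (real k / 2 ^ m) < n x (real (Suc k) / 2 ^ m)"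

definition open_path :: "'v set set \<Rightarrow> 'v set \<Rightarrow> 'v list \<Rightarrow> bool" where
  "open_path E S p \<longleftrightarrow> is_path E p \<and> set p \<subseteq> S"

text \<open>
  If no open path from \<open>x\<close> has exactly \<open>N\<close> vertices, then no longer one exists, as its initial
  segment would be open. The open cluster of \<open>x\<close>, together with its boundary, is the required finite set: each of
  its open vertices has all its neighbors inside.
\<close>
lemma finite_cluster_closure:
  assumes tr: "regular_tree d E"
    and bound: "\<And>p. open_path E S p \<Longrightarrow> hd p = x \<Longrightarrow> length p \<noteq> N" and N: "0 < N"
  obtains F where "finite F" "x \<in> F" "\<And>z. z \<in> F \<Longrightarrow> z \<in> S \<Longrightarrow> neighbors E z \<subseteq> F"
proof -
  have fin: "finite (neighbors E z)" for z using tr by (simp add: regular_tree_def)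
  define C where "C = {last p | p. open_path E S p \<and> hd p = x}"
  have short: "length p < Suc N" if "open_path E S p" "hd p = x" for p
  proof (rule ccontr)
    assume "\<not> length p < Suc N"
    then have l: "length p > N" by simp
    have "is_path E (take N p @ drop N p)" using that by (simp add: open_path_def)
      then have "is_path E (take N p)" by (rule is_path_prefix) (use N l in auto)
      then have "open_path E S (take N p)" using that by (auto simp: open_path_def dest: in_set_takeD)
      then show False using bound[of "take N p"] that l N by simp
  qed
  have "C \<subseteq> (\<Union>k<Suc N. last ` paths_from E x k)"
    using short by (auto simp: C_def paths_from_def open_path_def)
  then have "finite C" using finite_paths_from[OF tr] by (auto intro: finite_subset)
  define F where "F = insert x (C \<union> (\<Union>z\<in>C. neighbors E z))"
  have "finite F" using \<open>finite C\<close> fin by (auto simp: F_def)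
  moreover have "neighbors E z \<subseteq> F" if z: "z \<in> F" "z \<in> S" for z
  proof -
    have "z \<in> C"
    proof -
      consider "z = x" | "z \<in> C" | w where "w \<in> C" "z \<in> neighbors E w" using z(1) by (auto simp: F_def)
      then show ?thesis
      proof cases
        case 1
        then have "open_path E S [x]" using z by (simp add: open_path_def is_path_def)
        then show ?thesis using 1 unfolding C_def by force
      next
        case 3
        then obtain p where p: "open_path E S p" "hd p = x" "last p = w" by (auto simp: C_def)
        show ?thesis
        proof (cases "z \<in> set p")
          case True
          then obtain p1 p2 where p12: "p = (p1 @ [z]) @ p2" by (metis append.assoc append_Cons append_Nil split_list)
          then have "is_path E (p1 @ [z])" using p(1) is_path_prefix[of E "p1 @ [z]" p2] by (auto simp: open_path_def)
          then have "open_path E S (p1 @ [z])" using p(1) p12 by (auto simp: open_path_def)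
          moreover have "hd (p1 @ [z]) = x" using p(2) p12 by (cases p1) auto
          ultimately show ?thesis unfolding C_def by (metis (mono_tags, lifting) last_snoc mem_Collect_eq)
        next
          case False
          have ne: "p \<noteq> []" using p by (auto simp: open_path_def is_path_def)
          have "open_path E S (p @ [z])"
            using p z(2) 3(2) ne False
            by (simp add: open_path_def is_path_append neighbors_def is_path_Cons)
          moreover have "hd (p @ [z]) = x" using p(2) ne by simp
          ultimately show ?thesis unfolding C_def by (metis (mono_tags, lifting) last_snoc mem_Collect_eq)
        qed
      qed
    qed
    then show ?thesis by (auto simp: F_def)
  qed
  moreover have "x \<in> F" by (simp add: F_def)
  ultimately show ?thesis using that by blast
qed

text \<open>
  Induction over the time slots of length \<open>1/8\<close> (the cells of level 3). Within one slot the value at \<open>x\<close> depends only on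
  the values at the start of the slot in the finite set that \<open>finite_cluster_closure\<close>
  provides; on this set the two dynamics agree at the start of the slot once \<open>m\<close> is large, and
  they perform the same updates in every cell in which no two neighbors ring.
\<close>
lemma eventually_dyn_eq_path:
  assumes tr: "regular_tree 3 E" and mp: "median_path E n u"
    and perc: "\<And>x j. \<exists>N>0. \<forall>p. open_path E {z. cell_flag n 3 z j} p \<and> hd p = x \<longrightarrow> length p \<noteq> N"
    and sep: "\<And>x T. \<exists>m0. \<forall>m\<ge>m0. \<forall>k<T * 2 ^ m. \<forall>y\<in>neighbors E x.
       \<not> (cell_flag n m x k \<and> cell_flag n m y k)"
  shows "\<exists>m0. \<forall>m\<ge>m0. \<forall>k\<le>T * 2 ^ m. dyn E (\<lambda>x. u x 0) (cell_flag n m) k x = u x (real k / 2 ^ m)"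
proof -
  let ?D = "\<lambda>m. dyn E (\<lambda>x. u x 0) (cell_flag n m)"
  note c = median_path_counting[OF mp]
  have slot: "\<exists>m0\<ge>3. \<forall>m\<ge>m0. \<forall>k\<le>J * 2 ^ (m - 3). ?D m k x = u x (real k / 2 ^ m)" for J x
  proof (induction J arbitrary: x)
    case 0
    show ?case by auto
  next
    case (Suc J)
    let ?S = "{z. cell_flag n 3 z J}"
    obtain N where N: "N > 0" "\<And>p. open_path E ?S p \<Longrightarrow> hd p = x \<Longrightarrow> length p \<noteq> N" using perc[of J x] by auto
    obtain F where F: "finite F" "x \<in> F" "\<And>z. z \<in> F \<Longrightarrow> z \<in> ?S \<Longrightarrow> neighbors E z \<subseteq> F"
      using finite_cluster_closure[OF tr N(2,1)] by metis
    have "\<forall>z. \<exists>m0\<ge>3. \<forall>m\<ge>m0. \<forall>k\<le>J * 2 ^ (m - 3). ?D m k z = u z (real k / 2 ^ m)"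
      using Suc.IH by blast
    then obtain f where f: "\<And>z. f z \<ge> 3" "\<And>z m k. m \<ge> f z \<Longrightarrow> k \<le> J * 2 ^ (m - 3) \<Longrightarrow> ?D m k z = u z (real k / 2 ^ m)"
      by metis
    have "\<forall>z. \<exists>m0. \<forall>m\<ge>m0. \<forall>k<Suc J * 2 ^ m. \<forall>y\<in>neighbors E z. \<not> (cell_flag n m z k \<and> cell_flag n m y k)"
      using sep by blast
    then obtain g where g: "\<And>z m k y. m \<ge> g z \<Longrightarrow> k < Suc J * 2 ^ m \<Longrightarrow> y \<in> neighbors E z \<Longrightarrow>
        \<not> (cell_flag n m z k \<and> cell_flag n m y k)"
      by metis
    define m0 where "m0 = Max ((\<lambda>z. max (f z) (g z)) ` F)"
    have m0: "f z \<le> m0" "g z \<le> m0" if "z \<in> F" for z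
      using Max_ge[of "(\<lambda>z. max (f z) (g z)) ` F" "max (f z) (g z)"] F(1) that
      by (auto simp: m0_def)
    have "3 \<le> m0" using m0(1)[OF F(2)] f(1)[of x] by simp
    moreover have "\<forall>z\<in>F. ?D m k z = u z (real k / 2 ^ m)" if m: "m \<ge> m0" and k: "k \<le> Suc J * 2 ^ (m - 3)" for m k
      using k
    proof (induction k)
      case 0
      show ?case by simp
    next
      case (Suc k)
      have m3: "3 \<le> m" using m \<open>3 \<le> m0\<close> by simp
      then have pw: "(2::real) ^ m = 2 ^ (m - 3) * 8" "(2::nat) ^ m = 2 ^ (m - 3) * 8"
        using power_add[of "2::real" "m - 3" 3] power_add[of "2::nat" "m - 3" 3] by auto
      have IH: "\<forall>z\<in>F. ?D m k z = u z (real k / 2 ^ m)" using Suc by simp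
      show ?case
      proof (cases "Suc k \<le> J * 2 ^ (m - 3)")
        case True
        show ?thesis
        proof
          fix z assume "z \<in> F"
          then have "f z \<le> m" using m0(1) m by (meson le_trans)
          then show "?D m (Suc k) z = u z (real (Suc k) / 2 ^ m)" using f(2) True by blast
        qed
      next
        case False
        let ?a = "real k / 2 ^ m" and ?b = "real (Suc k) / 2 ^ m"
        have ab: "0 \<le> ?a" "?a \<le> ?b" by (auto simp: divide_right_mono)
        have "real J * 2 ^ (m - 3) \<le> real k" "real (Suc k) \<le> real (Suc J) * 2 ^ (m - 3)"
        proof -
          have "J * 2 ^ (m - 3) \<le> k" using False by simp
          then have "real (J * 2 ^ (m - 3)) \<le> real k" by (simp only: of_nat_le_iff)
          then show "real J * 2 ^ (m - 3) \<le> real k" by simp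
          have "real (Suc k) \<le> real (Suc J * 2 ^ (m - 3))" using Suc.prems by (simp only: of_nat_le_iff)
          then show "real (Suc k) \<le> real (Suc J) * 2 ^ (m - 3)" by (simp only: of_nat_mult of_nat_power of_nat_numeral)
        qed
        then have slot: "real J / 2 ^ 3 \<le> ?a" "?b \<le> real (Suc J) / 2 ^ 3"
          unfolding pw by (simp_all add: field_simps)
        have kk: "k < Suc J * 2 ^ m"
        proof -
          have "k < Suc J * 2 ^ (m - 3)" using Suc.prems by simp
          also have "\<dots> \<le> Suc J * 2 ^ m" by (intro mult_left_mono power_increasing) auto
          finally show ?thesis .
        qed
        show ?thesis
        proof
          fix z assume z: "z \<in> F"
          have same: "n y ?a = n y ?b" if "\<not> cell_flag n m y k" for y
            using that counting_path_mono[OF c ab, of y] by (simp add: cell_flag_def)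
          show "?D m (Suc k) z = u z ?b"
          proof (cases "cell_flag n m z k")
            case False
            then show ?thesis using IH z median_path_constant[OF mp ab(1) same[OF False] ab(2) order_refl] by simp
          next
            case True
            have "n z (real J / 2 ^ 3) \<le> n z ?a" "n z ?b \<le> n z (real (Suc J) / 2 ^ 3)"
              using slot ab by (auto intro!: counting_path_mono[OF c])
            then have "z \<in> ?S" using True by (simp add: cell_flag_def)
            then have nb: "neighbors E z \<subseteq> F" using F(3) z by blast
            have quiet: "n y ?a = n y ?b" if "y \<in> neighbors E z" for y
              using g[of z m k y] m0(2)[OF z] m kk that True same[of y] by auto
            have "u z ?b = median (image_mset (\<lambda>y. u y ?a) (mset_set (neighbors E z)))"
              using median_path_update[OF mp ab] True quiet by (simp add: cell_flag_def)
            also have "image_mset (\<lambda>y. u y ?a) (mset_set (neighbors E z)) =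
                image_mset (?D m k) (mset_set (neighbors E z))"
              using IH nb tr by (intro image_mset_cong) (auto simp: regular_tree_def)
            finally show ?thesis using True by simp
          qed
        qed
      qed
    qed
    ultimately show ?case using F(2) by blast
  qed
  obtain m0 where m0: "m0 \<ge> 3" "\<And>m k. m \<ge> m0 \<Longrightarrow> k \<le> (T * 8) * 2 ^ (m - 3) \<Longrightarrow> ?D m k x = u x (real k / 2 ^ m)"
    using slot[of "T * 8" x] by blast
  have "?D m k x = u x (real k / 2 ^ m)" if "m \<ge> m0" "k \<le> T * 2 ^ m" for m k
  proof -
    have "(2::nat) ^ m = 2 ^ (m - 3) * 8"
      using power_add[of "2::nat" "m - 3" 3] m0(1) that by simp
    then show ?thesis using m0(2)[of m k] that by simp
  qed
  then show ?thesis by blast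
qed

section \<open>Almost sure agreement with the synchronous dynamics\<close>

context median_tree
begin

text \<open>The tree has countably many vertices.\<close>
lemma AE_all_vertices:
  "(\<And>x. AE \<omega> in M. P x \<omega>) \<Longrightarrow> AE \<omega> in M. \<forall>x::'v. P x \<omega>"
  using AE_ball_countable[OF countable_vertices[OF tree], of "\<lambda>\<omega> x. P x \<omega>" M] by simp

lemma rang_eq_cell_flag: "rang m \<omega> = cell_flag (\<lambda>x t. N x t \<omega>) m"
  by (simp add: fun_eq_iff rang_def cell_flag_def)

lemma AE_median_path: "AE \<omega> in M. median_path E (\<lambda>x t. N x t \<omega>) (\<lambda>x t. U x t \<omega>)"
proof -
  have "AE \<omega> in M. counting_path (\<lambda>t. N x t \<omega>)" for x
    using clocks_poisson[of x] unfolding poisson_process_def counting_path_def by auto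
  then have "AE \<omega> in M. \<forall>x. counting_path (\<lambda>t. N x t \<omega>)" by (rule AE_all_vertices)
  with constant_between_rings update_at_rings show ?thesis
    by eventually_elim (simp add: median_path_def)
qed

lemma prob_all_rang:
  assumes "finite S"
  shows "prob {\<omega> \<in> space M. \<forall>z\<in>S. rang m \<omega> z k} \<le> (1 / 2 ^ m) ^ card S"
proof (cases "S = {}")
  case True then show ?thesis by simp
next
  case False
  let ?A = "{f :: nat \<Rightarrow> bool. f k}"
  have [measurable]: "(\<lambda>f :: nat \<Rightarrow> bool. f k) \<in> measurable (PiM UNIV (\<lambda>_. count_space UNIV)) (count_space UNIV)"
    by (rule measurable_component_singleton) simp
  have "{f \<in> space (PiM UNIV (\<lambda>_::nat. count_space (UNIV :: bool set))). f k} \<in> sets (PiM UNIV (\<lambda>_. count_space UNIV))"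
    by measurable
  then have A: "?A \<in> sets (PiM UNIV (\<lambda>_. count_space UNIV))" by (simp add: space_PiM)
  have "{\<omega> \<in> space M. \<forall>z\<in>S. rang m \<omega> z k} = (\<Inter>z\<in>S. (\<lambda>\<omega>. rang m \<omega> z) -` ?A \<inter> space M)"
    using False by auto
  then have "prob {\<omega> \<in> space M. \<forall>z\<in>S. rang m \<omega> z k} = (\<Prod>z\<in>S. prob ((\<lambda>\<omega>. rang m \<omega> z) -` ?A \<inter> space M))"
    using indep_varsD[OF indep_rang_vertices False assms subset_UNIV, of "\<lambda>_. ?A"] A by simp
  also have "\<dots> \<le> (\<Prod>z\<in>S. 1 / 2 ^ m)"
  proof (rule prod_mono)
    fix z
    have "(\<lambda>\<omega>. rang m \<omega> z) -` ?A \<inter> space M = {\<omega> \<in> space M. rang m \<omega> z k}" by auto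
    then show "0 \<le> prob ((\<lambda>\<omega>. rang m \<omega> z) -` ?A \<inter> space M) \<and> prob ((\<lambda>\<omega>. rang m \<omega> z) -` ?A \<inter> space M) \<le> 1 / 2 ^ m"
      using prob_rang[of m z k] by simp
  qed
  finally show ?thesis by simp
qed

text \<open>
  The length \<open>1/8\<close> of a slot makes percolation subcritical: there are at most \<open>3 ^ n\<close> paths with \<open>Suc n\<close> vertices
  from \<open>x\<close>, each with all its vertices ringing with probability at most \<open>(1/8) ^ Suc n\<close>. Borel--Cantelli applies.
\<close>
lemma AE_finite_clusters:
  "AE \<omega> in M. \<exists>N>0. \<forall>p. open_path E {z. rang 3 \<omega> z j} p \<and> hd p = x \<longrightarrow> length p \<noteq> N"
proof -
  define A where "A n = {\<omega> \<in> space M. \<exists>p\<in>paths_from E x (Suc n). \<forall>z\<in>set p. rang 3 \<omega> z j}" for n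
  have fin: "finite (paths_from E x (Suc n))" and card: "card (paths_from E x (Suc n)) \<le> 3 ^ n" for n
    using paths_from_bound[OF tree] by auto
  have [measurable]: "A n \<in> sets M" for n
    unfolding A_def using fin by measurable
  have "prob (A n) \<le> (3 / 8) ^ n" for n
  proof -
    have "A n = (\<Union>p\<in>paths_from E x (Suc n). {\<omega> \<in> space M. \<forall>z\<in>set p. rang 3 \<omega> z j})"
      by (auto simp: A_def)
    then have "prob (A n) \<le> (\<Sum>p\<in>paths_from E x (Suc n). prob {\<omega> \<in> space M. \<forall>z\<in>set p. rang 3 \<omega> z j})"
      by (simp only:) (rule measure_UNION_le[OF fin], measurable)
    also have "\<dots> \<le> (\<Sum>p\<in>paths_from E x (Suc n). (1 / 8) ^ Suc n)"
    proof (rule sum_mono)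
      fix p assume "p \<in> paths_from E x (Suc n)"
      then have "card (set p) = Suc n" by (auto simp: paths_from_def is_path_def distinct_card)
      then show "prob {\<omega> \<in> space M. \<forall>z\<in>set p. rang 3 \<omega> z j} \<le> (1 / 8) ^ Suc n"
        using prob_all_rang[of "set p" 3 j] by simp
    qed
    also have "\<dots> \<le> 3 ^ n * (1 / 8) ^ n"
    proof -
      have "real (card (paths_from E x (Suc n))) \<le> 3 ^ n"
        using card[of n] by (metis of_nat_le_iff of_nat_numeral of_nat_power)
      then have "real (card (paths_from E x (Suc n))) * (1 / 8) ^ Suc n \<le> 3 ^ n * (1 / 8) ^ n"
        by (rule mult_mono) (auto intro: power_decreasing)
      then show ?thesis by (simp only: sum_constant)
    qed
    finally show ?thesis by (simp add: power_mult_distrib[symmetric])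
  qed
  then have "summable (\<lambda>n. prob (A n))"
    by (intro summable_comparison_test'[OF summable_geometric[of "3 / 8 :: real"], of 0]) auto
  then have "AE \<omega> in M. eventually (\<lambda>n. \<omega> \<in> space M - A n) sequentially"
    by (intro borel_cantelli_AE1) (auto simp: emeasure_eq_measure)
  then show ?thesis
  proof eventually_elim
    case (elim \<omega>)
    then obtain n where n: "\<omega> \<in> space M - A n" by (auto simp: eventually_sequentially)
    have "length p \<noteq> Suc n" if "open_path E {z. rang 3 \<omega> z j} p" "hd p = x" for p
      using n that by (auto simp: A_def open_path_def paths_from_def)
    then show ?case by blast
  qed
qed

text \<open>
  Two neighbors ring in the same cell with probability at most \<open>4\<^sup>-\<^sup>m\<close>, and there are \<open>T * 2 ^ m\<close> cells up to
  time \<open>T\<close>; the resulting bound \<open>T * 2\<^sup>-\<^sup>m\<close> is summable.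
\<close>
lemma AE_neighbors_separated:
  assumes y: "y \<in> neighbors E x"
  shows "AE \<omega> in M. \<exists>m0. \<forall>m\<ge>m0. \<forall>k<T * 2 ^ m. \<not> (rang m \<omega> x k \<and> rang m \<omega> y k)"
proof -
  have xy: "x \<noteq> y" using y tree by (auto simp: neighbors_def regular_tree_def)
  define B where "B m = {\<omega> \<in> space M. \<exists>k<T * 2 ^ m. rang m \<omega> x k \<and> rang m \<omega> y k}" for m
  have [measurable]: "B m \<in> sets M" for m unfolding B_def by measurable
  have "prob (B m) \<le> real T * (1 / 2) ^ m" for m
  proof -
    have "B m = (\<Union>k\<in>{..<T * 2 ^ m}. {\<omega> \<in> space M. \<forall>z\<in>{x, y}. rang m \<omega> z k})" by (auto simp: B_def)
    then have "prob (B m) \<le> (\<Sum>k\<in>{..<T * 2 ^ m}. prob {\<omega> \<in> space M. \<forall>z\<in>{x, y}. rang m \<omega> z k})"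
      by (simp only:) (rule measure_UNION_le, simp, measurable)
    also have "\<dots> \<le> (\<Sum>k\<in>{..<T * 2 ^ m}. (1 / 2 ^ m) ^ 2)"
      using prob_all_rang[of "{x, y}" m] xy by (intro sum_mono) (simp add: card_insert_if power2_eq_square)
    also have "\<dots> = real T * (1 / 2) ^ m" by (simp add: power2_eq_square power_divide)
    finally show ?thesis .
  qed
  then have "summable (\<lambda>m. prob (B m))"
    by (intro summable_comparison_test'[OF summable_mult[OF summable_geometric[of "1 / 2 :: real"]], of 0 _ "real T"]) auto
  then have "AE \<omega> in M. eventually (\<lambda>m. \<omega> \<in> space M - B m) sequentially"
    by (intro borel_cantelli_AE1) (auto simp: emeasure_eq_measure)
  then show ?thesis by eventually_elim (auto simp: eventually_sequentially B_def)
qed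

lemma AE_separated:
  "AE \<omega> in M. \<forall>x T. \<exists>m0. \<forall>m\<ge>m0. \<forall>k<T * 2 ^ m. \<forall>y\<in>neighbors E x. \<not> (rang m \<omega> x k \<and> rang m \<omega> y k)"
proof (intro AE_all_vertices)
  fix x
  have fin: "finite (neighbors E x)" using tree by (simp add: regular_tree_def)
  have "AE \<omega> in M. \<forall>y\<in>neighbors E x. \<forall>T. \<exists>m0. \<forall>m\<ge>m0. \<forall>k<T * 2 ^ m. \<not> (rang m \<omega> x k \<and> rang m \<omega> y k)"
    using AE_neighbors_separated by (intro AE_finite_allI[OF fin]) (simp add: AE_all_countable)
  then show "AE \<omega> in M. \<forall>T. \<exists>m0. \<forall>m\<ge>m0. \<forall>k<T * 2 ^ m. \<forall>y\<in>neighbors E x. \<not> (rang m \<omega> x k \<and> rang m \<omega> y k)"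
  proof eventually_elim
    case (elim \<omega>)
    show ?case
    proof
      fix T
      have "\<forall>y\<in>neighbors E x. \<exists>m0. \<forall>m\<ge>m0. \<forall>k<T * 2 ^ m. \<not> (rang m \<omega> x k \<and> rang m \<omega> y k)"
        using elim by blast
      then obtain f where f: "\<And>y m k. y \<in> neighbors E x \<Longrightarrow> m \<ge> f y \<Longrightarrow> k < T * 2 ^ m \<Longrightarrow> \<not> (rang m \<omega> x k \<and> rang m \<omega> y k)"
        by metis
      have "\<not> (rang m \<omega> x k \<and> rang m \<omega> y k)"
        if "m \<ge> Max (f ` neighbors E x)" "k < T * 2 ^ m" "y \<in> neighbors E x" for m k y
      proof -
        have "f y \<le> Max (f ` neighbors E x)" using fin that(3) by simp
        then show ?thesis using f[OF that(3) _ that(2)] that(1) by simp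
      qed
      then show "\<exists>m0. \<forall>m\<ge>m0. \<forall>k<T * 2 ^ m. \<forall>y\<in>neighbors E x. \<not> (rang m \<omega> x k \<and> rang m \<omega> y k)"
        by blast
    qed
  qed
qed

lemma AE_rings_unbounded: "AE \<omega> in M. \<forall>x n. \<exists>k\<ge>n. rang 0 \<omega> x k"
proof (intro AE_all_vertices)
  fix x
  have "AE \<omega> in M. \<exists>k\<ge>n. rang 0 \<omega> x k" for n
  proof -
    define A where "A = {\<omega> \<in> space M. \<forall>k\<ge>n. \<not> rang 0 \<omega> x k}"
    have [measurable]: "A \<in> sets M" unfolding A_def by measurable
    have "prob A \<le> exp (- 1) ^ K" for K
    proof (cases "K = 0")
      case False
      let ?J = "{n..<n + K}"
      have "A \<subseteq> (\<Inter>k\<in>?J. (\<lambda>\<omega>. rang 0 \<omega> x k) -` {False} \<inter> space M)" by (intro subsetI INT_I) (simp add: A_def)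
      moreover have "(\<Inter>k\<in>?J. (\<lambda>\<omega>. rang 0 \<omega> x k) -` {False} \<inter> space M) \<in> sets M"
      proof (rule sets.finite_INT)
        fix k
        show "(\<lambda>\<omega>. rang 0 \<omega> x k) -` {False} \<inter> space M \<in> sets M"
          by (rule measurable_sets[OF measurable_rang]) simp
      qed (use False in simp_all)
      ultimately have "prob A \<le> prob (\<Inter>k\<in>?J. (\<lambda>\<omega>. rang 0 \<omega> x k) -` {False} \<inter> space M)"
        by (rule finite_measure_mono)
      also have "\<dots> = (\<Prod>k\<in>?J. prob ((\<lambda>\<omega>. rang 0 \<omega> x k) -` {False} \<inter> space M))"
        by (rule indep_varsD[OF indep_rang_times]) (use False in simp_all)
      also have "\<dots> = (\<Prod>k\<in>?J. exp (- 1))"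
      proof (rule prod.cong[OF refl])
        fix k
        have "(\<lambda>\<omega>. rang 0 \<omega> x k) -` {False} \<inter> space M = {\<omega> \<in> space M. \<not> rang 0 \<omega> x k}" by auto
        then show "prob ((\<lambda>\<omega>. rang 0 \<omega> x k) -` {False} \<inter> space M) = exp (- 1)"
          using prob_not_rang[of 0 x k] by simp
      qed
      finally show ?thesis by simp
    qed simp
    moreover have "(\<lambda>K. exp (- 1 :: real) ^ K) \<longlonglongrightarrow> 0" by (rule LIMSEQ_realpow_zero) auto
    ultimately have "prob A \<le> 0" by (intro LIMSEQ_le_const[of _ 0]) auto
    then have "prob A = 0" by (simp add: measure_le_0_iff)
    then have "AE \<omega> in M. \<omega> \<notin> A" using prob_eq_0 by simp
    then show ?thesis by (rule AE_mp) (auto simp: A_def)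
  qed
  then show "AE \<omega> in M. \<forall>n. \<exists>k\<ge>n. rang 0 \<omega> x k" by (simp add: AE_all_countable)
qed

definition approx :: "nat \<Rightarrow> 'w \<Rightarrow> nat \<Rightarrow> 'v \<Rightarrow> real" where
  "approx m \<omega> = dyn E (initial \<omega>) (rang m \<omega>)"

lemma AE_approx_eq:
  "AE \<omega> in M. \<forall>x T. \<exists>m0. \<forall>m\<ge>m0. \<forall>k\<le>T * 2 ^ m. approx m \<omega> k x = U x (real k / 2 ^ m) \<omega>"
proof -
  have "AE \<omega> in M. \<forall>x j. \<exists>N>0. \<forall>p. open_path E {z. rang 3 \<omega> z j} p \<and> hd p = x \<longrightarrow> length p \<noteq> N"
    using AE_finite_clusters by (intro AE_all_vertices) (simp add: AE_all_countable)
  with AE_median_path AE_separated show ?thesis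
  proof eventually_elim
    case (elim \<omega>)
    show ?case
    proof (intro allI)
      fix x T
      show "\<exists>m0. \<forall>m\<ge>m0. \<forall>k\<le>T * 2 ^ m. approx m \<omega> k x = U x (real k / 2 ^ m) \<omega>"
        using eventually_dyn_eq_path[OF tree elim(1), of T x] elim(2,3)
        unfolding approx_def rang_eq_cell_flag initial_def[abs_def] by blast
    qed
  qed
qed

end

section \<open>Convergence of the median process\<close>

lemma abs_diff_le_variation:
  fixes f :: "nat \<Rightarrow> real"
  assumes "j \<le> i"
  shows "\<bar>f i - f j\<bar> \<le> (\<Sum>k\<in>{j..<i}. \<bar>f (Suc k) - f k\<bar>)"
  using assms by (induction i rule: dec_induct) auto

text \<open>
  The variation over dyadic grids increases both with the time horizon and with refinement. Beyond a horizon
  \<open>T0\<close> at which it is within \<open>e\<close> of its supremum, the function stays within \<open>e\<close> of its value at \<open>T0\<close>;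
  local constancy to the right extends this from dyadic to all times.
\<close>
lemma convergent_of_bounded_dyadic_variation:
  fixes u :: "real \<Rightarrow> real"
  assumes bound: "\<And>T m0. \<exists>m\<ge>m0. (\<Sum>k<T * 2 ^ m. \<bar>u (real (Suc k) / 2 ^ m) - u (real k / 2 ^ m)\<bar>) \<le> B"
    and right: "\<And>t. 0 \<le> t \<Longrightarrow> \<exists>e>t. \<forall>s. t < s \<and> s < e \<longrightarrow> u s = u t"
  shows "\<exists>L. (u \<longlongrightarrow> L) at_top"
proof -
  define S where "S T m = (\<Sum>k<T * 2 ^ m. \<bar>u (real (Suc k) / 2 ^ m) - u (real k / 2 ^ m)\<bar>)" for T m :: nat
  have S_Suc: "S T m \<le> S T (Suc m)" for T m
  proof -
    let ?g = "\<lambda>k. \<bar>u (real (Suc k) / 2 ^ Suc m) - u (real k / 2 ^ Suc m)\<bar>"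
    have "S T (Suc m) = (\<Sum>k<T * 2 ^ m. sum ?g {k * 2..<k * 2 + 2})"
      unfolding S_def by (subst sum.nat_group) (simp add: mult_ac)
    moreover have "\<bar>u (real (Suc k) / 2 ^ m) - u (real k / 2 ^ m)\<bar> \<le> sum ?g {k * 2..<k * 2 + 2}" for k
    proof -
      have "real (k * 2) / 2 ^ Suc m = real k / 2 ^ m" "real (k * 2 + 2) / 2 ^ Suc m = real (Suc k) / 2 ^ m"
        by (simp_all add: field_simps)
      then show ?thesis
        using abs_diff_le_variation[of "k * 2" "k * 2 + 2" "\<lambda>k. u (real k / 2 ^ Suc m)"] by simp
    qed
    ultimately show ?thesis by (simp add: S_def sum_mono)
  qed
  have S_mono: "S T m \<le> S T m'" if "m \<le> m'" for T m m'
    using S_Suc lift_Suc_mono_le[of "S T" m m'] that by blast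
  have S_le: "S T m \<le> B" for T m
  proof -
    obtain m' where "m' \<ge> m" "S T m' \<le> B" using bound unfolding S_def by blast
    then show ?thesis using S_mono[of m m' T] by simp
  qed
  let ?R = "range (\<lambda>(T, m). S T m)"
  have bdd: "bdd_above ?R" using S_le by (intro bdd_aboveI[of _ B]) auto
  define \<sigma> where "\<sigma> = Sup ?R"
  have le_\<sigma>: "S T m \<le> \<sigma>" for T m
    unfolding \<sigma>_def using bdd by (intro cSup_upper) auto
  have cauchy: "\<exists>T0::nat. \<forall>t\<ge>real T0. \<bar>u t - u (real T0)\<bar> < e" if "0 < e" for e
  proof -
    have "\<exists>r\<in>?R. \<sigma> - e < r"
      using that less_cSup_iff[of ?R "\<sigma> - e"] bdd by (auto simp: \<sigma>_def)
    then obtain T0 m0 where T0: "\<sigma> - e < S T0 m0" by auto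
    have "\<bar>u t - u (real T0)\<bar> < e" if t: "real T0 \<le> t" for t
    proof -
      have t0: "0 \<le> t" using t by (meson of_nat_0_le_iff order_trans)
      obtain b where b: "b > t" "\<And>s. t < s \<Longrightarrow> s < b \<Longrightarrow> u s = u t" using right[OF t0] by blast
      obtain m1 where m1: "1 / (b - t) < 2 ^ m1" using real_arch_pow[of 2 "1 / (b - t)"] by auto
      define m where "m = max m0 m1"
      have "(2::real) ^ m1 \<le> 2 ^ m" by (intro power_increasing) (auto simp: m_def)
      then have m: "1 / (b - t) < 2 ^ m" by (rule less_le_trans[OF m1])
      \<comment> \<open>The first grid point of level \<open>m\<close> to the right of \<open>t\<close>; there the function still has its value at \<open>t\<close>.\<close>
      define i where "i = nat \<lfloor>t * 2 ^ m\<rfloor> + 1"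
      have fl: "real i = of_int \<lfloor>t * 2 ^ m\<rfloor> + 1" using t0 by (simp add: i_def)
      have i: "t < real i / 2 ^ m" "real i / 2 ^ m < b"
      proof -
        have "t * 2 ^ m < real i" unfolding fl by linarith
        then show "t < real i / 2 ^ m" by (simp add: field_simps)
        have "real i \<le> t * 2 ^ m + 1" unfolding fl by linarith
        also have "\<dots> < b * 2 ^ m" using m b(1) by (simp add: field_simps)
        finally show "real i / 2 ^ m < b" by (simp add: field_simps)
      qed
      have "real (T0 * 2 ^ m) \<le> t * 2 ^ m" using t by (simp add: mult_right_mono)
      also have "\<dots> \<le> real i" using i(1) by (simp add: field_simps)
      finally have Ti: "T0 * 2 ^ m \<le> i" by (simp only: of_nat_le_iff)
      have T: "i \<le> i * 2 ^ m" by simp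
      let ?f = "\<lambda>k. u (real k / 2 ^ m)"
      let ?d = "\<lambda>k. \<bar>?f (Suc k) - ?f k\<bar>"
      have "S T0 m + (\<Sum>k\<in>{T0 * 2 ^ m..<i}. ?d k) = (\<Sum>k<i. ?d k)"
        unfolding S_def using Ti by (simp add: lessThan_atLeast0 sum.atLeastLessThan_concat)
      also have "\<dots> \<le> S i m" unfolding S_def using T by (intro sum_mono2) auto
      also have "\<dots> \<le> \<sigma>" by (rule le_\<sigma>)
      finally have "S T0 m + (\<Sum>k\<in>{T0 * 2 ^ m..<i}. ?d k) \<le> \<sigma>" .
      moreover have "\<bar>?f i - ?f (T0 * 2 ^ m)\<bar> \<le> (\<Sum>k\<in>{T0 * 2 ^ m..<i}. ?d k)"
        by (rule abs_diff_le_variation[OF Ti])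
      moreover have "S T0 m0 \<le> S T0 m" by (rule S_mono) (simp add: m_def)
      moreover have "?f i = u t" using b(2) i by blast
      moreover have "?f (T0 * 2 ^ m) = u (real T0)" by simp
      ultimately show ?thesis using T0 by linarith
    qed
    then show ?thesis by blast
  qed
  have "convergent (\<lambda>n. u (real n))"
  proof (rule Cauchy_convergent, rule metric_CauchyI)
    fix e :: real assume "0 < e"
    then obtain T0 :: nat where T0: "\<And>t. t \<ge> real T0 \<Longrightarrow> \<bar>u t - u (real T0)\<bar> < e / 2"
      using cauchy[of "e / 2"] by auto
    have "dist (u (real m)) (u (real n)) < e" if "m \<ge> T0" "n \<ge> T0" for m n
    proof -
      have "\<bar>u (real m) - u (real T0)\<bar> < e / 2" "\<bar>u (real n) - u (real T0)\<bar> < e / 2"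
        using that by (intro T0; simp)+
      then show ?thesis unfolding dist_real_def by linarith
    qed
    then show "\<exists>M. \<forall>m\<ge>M. \<forall>n\<ge>M. dist (u (real m)) (u (real n)) < e" by blast
  qed
  then obtain L where L: "(\<lambda>n. u (real n)) \<longlonglongrightarrow> L" by (auto simp: convergent_def)
  have "(u \<longlongrightarrow> L) at_top"
  proof (rule tendstoI)
    fix e :: real assume e: "0 < e"
    then obtain T0 :: nat where T0: "\<And>t. t \<ge> real T0 \<Longrightarrow> \<bar>u t - u (real T0)\<bar> < e / 3"
      using cauchy[of "e / 3"] by auto
    obtain n0 where "\<And>n. n \<ge> n0 \<Longrightarrow> dist (u (real n)) L < e / 3"
      using L e unfolding lim_sequentially by (meson divide_pos_pos zero_less_numeral)
    then have n: "\<bar>u (real (max n0 T0)) - L\<bar> < e / 3" by (simp add: dist_real_def)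
    have "dist (u t) L < e" if "t \<ge> real T0" for t
    proof -
      have "\<bar>u (real (max n0 T0)) - u (real T0)\<bar> < e / 3" by (rule T0) simp
      then show ?thesis using T0[OF that] n unfolding dist_real_def by linarith
    qed
    then show "eventually (\<lambda>t. dist (u t) L < e) at_top"
      by (auto simp: eventually_at_top_linorder)
  qed
  then show ?thesis by blast
qed

lemma median_path_right_constant:
  assumes mp: "median_path E n u" and t: "0 \<le> t"
  shows "\<exists>e>t. \<forall>s. t < s \<and> s < e \<longrightarrow> u x s = u x t"
proof -
  obtain e where e: "e > t" "\<And>s. t < s \<Longrightarrow> s < e \<Longrightarrow> n x s = n x t"
    using counting_path_right_constant[OF median_path_counting[OF mp, of x] t] by auto
  have "u x s = u x t" if "t < s" "s < e" for s
    using median_path_constant[OF mp t e(2)[OF that, symmetric], of s] that by simp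
  then show ?thesis using e(1) by blast
qed

text \<open>
  The left limits in the update rule are values actually attained shortly before, so convergence of
  the paths carries over to them.
\<close>
lemma median_path_left_limit:
  assumes mp: "median_path E n u" and t: "0 < t"
  shows "\<exists>s\<ge>0. s < t \<and> (\<forall>r. s \<le> r \<and> r < t \<longrightarrow> left_limit (u y) t = u y r)"
proof -
  note c = median_path_counting[OF mp, of y]
  have "\<exists>s. (0 \<le> s \<and> s < t) \<and> (\<forall>r. 0 \<le> r \<and> r < t \<longrightarrow> n y r \<le> n y s)"
    by (rule ex_has_greatest_nat[of _ 0 _ "Suc (n y t)"])
      (use t counting_path_mono[OF c, of _ t] in \<open>auto simp: less_Suc_eq_le\<close>)
  then obtain s where s: "0 \<le> s" "s < t" "\<And>r. 0 \<le> r \<Longrightarrow> r < t \<Longrightarrow> n y r \<le> n y s" by blast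
  have eq: "u y r = u y s" if "s \<le> r" "r < t" for r
  proof -
    have "n y s = n y r" using s(1) s(3)[of r] counting_path_mono[OF c s(1) that(1)] that by simp
    from median_path_constant[OF mp s(1) this that(1) order_refl] show ?thesis .
  qed
  have "s < t \<and> (\<forall>r>s. r < t \<longrightarrow> u y s = u y r)"
    using s(2) by (intro conjI allI impI eq[symmetric]) simp_all
  then have "eventually (\<lambda>r. u y s = u y r) (at_left t)"
    unfolding eventually_at_left_field by blast
  then have "(u y \<longlongrightarrow> u y s) (at_left t)"
    by (rule tendsto_eventually[OF eventually_mono]) simp
  then have "left_limit (u y) t = u y s"
    unfolding left_limit_def by (intro tendsto_Lim) auto
  then have "left_limit (u y) t = u y r" if "s \<le> r" "r < t" for r
    using eq[OF that] by simp
  then show ?thesis using s(1,2) by blast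
qed

lemma median3_lipschitz:
  assumes "\<bar>a - a'\<bar> \<le> e" "\<bar>b - b'\<bar> \<le> e" "\<bar>c - c'\<bar> \<le> e"
  shows "\<bar>median3 a b c - median3 a' b' c'\<bar> \<le> e"
  using assms unfolding median3_def by (smt (verit))

text \<open>
  At an update after a late time all four values involved are within \<open>e\<close> of their limits.
\<close>
lemma limit_stationary:
  assumes tr: "regular_tree 3 E" and mp: "median_path E n u"
    and lim: "\<And>x. (u x \<longlongrightarrow> V x) at_top"
    and rings: "\<And>x j. \<exists>k\<ge>j. cell_flag n 0 x k"
  shows "stationary E V"
  unfolding stationary_def
proof
  fix x
  obtain a b c where nb: "neighbors E x = {a, b, c}" "a \<noteq> b" "a \<noteq> c" "b \<noteq> c"
    using neighbors_triple[OF tr] by metis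
  have "\<bar>V x - median3 (V a) (V b) (V c)\<bar> \<le> 2 * e" if e: "0 < e" for e
  proof -
    have "eventually (\<lambda>t. \<bar>u x t - V x\<bar> < e \<and> \<bar>u a t - V a\<bar> < e \<and> \<bar>u b t - V b\<bar> < e \<and> \<bar>u c t - V c\<bar> < e) at_top"
      using tendstoD[OF lim e] by (auto simp: dist_real_def intro!: eventually_conj)
    then obtain T where T: "\<And>t. t \<ge> T \<Longrightarrow> \<bar>u x t - V x\<bar> < e" "\<And>t. t \<ge> T \<Longrightarrow> \<bar>u a t - V a\<bar> < e"
      "\<And>t. t \<ge> T \<Longrightarrow> \<bar>u b t - V b\<bar> < e" "\<And>t. t \<ge> T \<Longrightarrow> \<bar>u c t - V c\<bar> < e"
      by (auto simp: eventually_at_top_linorder)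
    obtain k where k: "k \<ge> nat \<lceil>T\<rceil>" "cell_flag n 0 x k" using rings by blast
    then have "T \<le> real k" by linarith
    have "n x (real k) < n x (real (Suc k))" using k(2) by (simp add: cell_flag_def)
    then obtain t where t: "t \<in> rings (n x)" "real k < t"
      using ring_between[OF median_path_counting[OF mp], of "real k" x "real (Suc k)"] by auto
    have T_t: "T < t" and t0: "0 < t" using t(2) \<open>T \<le> real k\<close> by auto
    have left: "\<exists>r\<ge>T. left_limit (u y) t = u y r" for y
    proof -
      obtain s where s: "s < t" "\<And>r. s \<le> r \<Longrightarrow> r < t \<Longrightarrow> left_limit (u y) t = u y r"
        using median_path_left_limit[OF mp t0] by blast
      show ?thesis using s(2)[of "max s T"] s(1) T_t by (intro exI[of _ "max s T"]) auto
    qed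
    have "\<bar>left_limit (u a) t - V a\<bar> \<le> e" "\<bar>left_limit (u b) t - V b\<bar> \<le> e" "\<bar>left_limit (u c) t - V c\<bar> \<le> e"
      using left[of a] left[of b] left[of c] T by (auto simp: less_imp_le)
    then have "\<bar>median3 (left_limit (u a) t) (left_limit (u b) t) (left_limit (u c) t) - median3 (V a) (V b) (V c)\<bar> \<le> e"
      by (rule median3_lipschitz)
    moreover have "u x t = median3 (left_limit (u a) t) (left_limit (u b) t) (left_limit (u c) t)"
      using median_path_ring[OF mp t(1)] median_neighbors_triple[OF nb, of "\<lambda>y. left_limit (u y) t"] by simp
    ultimately show ?thesis using T(1)[of t] T_t by simp
  qed
  then have "\<bar>V x - median3 (V a) (V b) (V c)\<bar> \<le> 0 + e" if "0 < e" for e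
    using that[THEN half_gt_zero] by fastforce
  then have "\<bar>V x - median3 (V a) (V b) (V c)\<bar> \<le> 0" by (rule field_le_epsilon)
  then show "V x = median (image_mset V (mset_set (neighbors E x)))"
    unfolding median_neighbors_triple[OF nb] by simp
qed

lemma dyn_unit:
  assumes tr: "regular_tree 3 E" and a: "\<And>x. a x \<in> {0..1}"
  shows "dyn E a r k x \<in> {0..1}"
proof (induction k arbitrary: x)
  case (Suc k)
  obtain y b c where n: "neighbors E x = {y, b, c}" "y \<noteq> b" "y \<noteq> c" "b \<noteq> c"
    using neighbors_triple[OF tr] by metis
  show ?case using Suc.IH[of x] Suc.IH[of y] Suc.IH[of b] Suc.IH[of c]
    by (auto simp: median_neighbors_triple[OF n] median3_def)
qed (use a in simp)

context median_tree
begin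

lemma measurable_approx [measurable]: "(\<lambda>\<omega>. approx m \<omega> k x) \<in> borel_measurable M"
proof -
  have "(\<lambda>\<omega>. (initial \<omega>, rang m \<omega>)) \<in> measurable M (initial_space \<Otimes>\<^sub>M flag_space)"
    using measurable_initial measurable_flags by measurable
  from measurable_compose[OF this measurable_dyn[OF tree, of k x]] show ?thesis
    by (simp add: approx_def)
qed

lemma AE_approx_unit: "AE \<omega> in M. \<forall>m k x. approx m \<omega> k x \<in> {0..1}"
  using values_in_unit
  by eventually_elim (use dyn_unit[OF tree] in \<open>auto simp: approx_def initial_def\<close>)

lemma integrable_of_approx_bound:
  assumes [measurable]: "f \<in> borel_measurable M"
    and b: "\<And>\<omega>. (\<forall>m k x. approx m \<omega> k x \<in> {0..1}) \<Longrightarrow> \<bar>f \<omega>\<bar> \<le> (B :: real)"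
  shows "integrable M f"
  by (rule integrable_const_bound[of _ B]) (use AE_approx_unit b in \<open>auto elim: eventually_mono\<close>)

text \<open>
  The change of the discrepancy between \<open>x\<close> and \<open>y\<close> that would result from the update of \<open>x\<close> alone. Its
  expectation is the same for all oriented edges, by invariance, and its sum over the neighbors of \<open>x\<close> is
  controlled by the median property.
\<close>
definition gain :: "nat \<Rightarrow> nat \<Rightarrow> 'v \<Rightarrow> 'v \<Rightarrow> 'w \<Rightarrow> real" where
  "gain m k x y \<omega> = \<bar>approx m \<omega> (Suc k) x - approx m \<omega> k y\<bar> - \<bar>approx m \<omega> k x - approx m \<omega> k y\<bar>"

lemma measurable_gain [measurable]: "gain m k x y \<in> borel_measurable M"
  unfolding gain_def[abs_def] by measurable

lemma integrable_gain: "integrable M (gain m k x y)"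
proof (rule integrable_of_approx_bound[of _ 1])
  fix \<omega> assume u: "\<forall>m k x. approx m \<omega> k x \<in> {0..1}"
  then have "approx m \<omega> (Suc k) x \<in> {0..1}" "approx m \<omega> k x \<in> {0..1}" "approx m \<omega> k y \<in> {0..1}" by blast+
  then show "\<bar>gain m k x y \<omega>\<bar> \<le> 1" unfolding gain_def by auto
qed simp

text \<open>The automorphisms act transitively on oriented edges.\<close>
lemma expectation_gain_eq:
  assumes xy: "y \<in> neighbors E x" and xy': "y' \<in> neighbors E x'"
  shows "expectation (gain m k x y) = expectation (gain m k x' y')"
proof -
  have path: "is_path E [v, w]" if "w \<in> neighbors E v" for v w
    using that tree by (auto simp: neighbors_def is_path_def regular_tree_def)
  obtain \<phi> where \<phi>: "automorphism E \<phi>" "map \<phi> [x, y] = [x', y']"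
    using tree_path_transitive[OF tree path[OF xy] path[OF xy']] by auto
  define H where "H p = \<bar>dyn E (fst p) (snd p) (Suc k) x - dyn E (fst p) (snd p) k y\<bar> -
    \<bar>dyn E (fst p) (snd p) k x - dyn E (fst p) (snd p) k y\<bar>" for p
  have [measurable]: "(\<lambda>p. dyn E (fst p) (snd p) k z) \<in> borel_measurable (initial_space \<Otimes>\<^sub>M flag_space)" for k z
    using measurable_dyn[OF tree, of k z] by (simp add: case_prod_beta)
  have "H \<in> borel_measurable (initial_space \<Otimes>\<^sub>M flag_space)" unfolding H_def[abs_def] by measurable
  from expectation_automorphism[OF \<phi>(1) this, of m]
  show ?thesis using \<phi>(2)
    by (simp add: H_def gain_def[abs_def] approx_def dyn_automorphism[OF \<phi>(1)] del: dyn.simps)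
qed

lemma gain_sum_le:
  assumes n: "neighbors E x = {a, b, c}" "a \<noteq> b" "a \<noteq> c" "b \<noteq> c"
  shows "gain m k x a \<omega> + gain m k x b \<omega> + gain m k x c \<omega> + \<bar>approx m \<omega> (Suc k) x - approx m \<omega> k x\<bar> \<le> 0"
proof (cases "rang m \<omega> x k")
  case True
  then have "approx m \<omega> (Suc k) x = median3 (approx m \<omega> k a) (approx m \<omega> k b) (approx m \<omega> k c)"
    by (simp add: approx_def median_neighbors_triple[OF n])
  then show ?thesis
    using median3_contraction[of "approx m \<omega> k a" "approx m \<omega> k b" "approx m \<omega> k c" "approx m \<omega> k x"]
    by (simp add: gain_def)
qed (simp add: gain_def approx_def)

text \<open>
  The actual change splits into the two one-sided gains unless both ends ring in the same cell. In
  that event the left-hand side is at most 1 and each gain at least \<open>- 1\<close>, hence the constant 3.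
\<close>
lemma discrepancy_step:
  assumes u: "\<forall>m k x. approx m \<omega> k x \<in> {0..1}" and "\<omega> \<in> space M"
  shows "\<bar>approx m \<omega> (Suc k) x - approx m \<omega> (Suc k) y\<bar> \<le> \<bar>approx m \<omega> k x - approx m \<omega> k y\<bar> +
    gain m k x y \<omega> + gain m k y x \<omega> + 3 * indicator {\<omega> \<in> space M. \<forall>z\<in>{x, y}. rang m \<omega> z k} \<omega>"
proof -
  have "approx m \<omega> (Suc k) x \<in> {0..1}" "approx m \<omega> k x \<in> {0..1}"
    "approx m \<omega> (Suc k) y \<in> {0..1}" "approx m \<omega> k y \<in> {0..1}" using u by blast+
  moreover have "approx m \<omega> (Suc k) z = approx m \<omega> k z" if "\<not> rang m \<omega> z k" for z
    using that by (simp add: approx_def)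
  ultimately show ?thesis using assms(2)
    by (cases "rang m \<omega> x k"; cases "rang m \<omega> y k") (auto simp: gain_def)
qed

text \<open>
  Let \<open>d\<close> be the common expectation of the gains. The three gains at \<open>x\<close> and the move of \<open>x\<close> add up to at
  most 0, so the expected move is at most \<open>- 3 * d\<close>; the expected discrepancy along an edge changes by
  \<open>2 * d\<close>, up to the probability of simultaneous rings.
\<close>
lemma expected_variation_step:
  assumes y: "y \<in> neighbors E x"
  shows "2 * expectation (\<lambda>\<omega>. \<bar>approx m \<omega> (Suc k) x - approx m \<omega> k x\<bar>) \<le>
    3 * (expectation (\<lambda>\<omega>. \<bar>approx m \<omega> k x - approx m \<omega> k y\<bar>)
      - expectation (\<lambda>\<omega>. \<bar>approx m \<omega> (Suc k) x - approx m \<omega> (Suc k) y\<bar>)) + 9 * (1 / 4) ^ m"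
proof -
  have x: "x \<in> neighbors E y" using y by (simp add: neighbors_def insert_commute)
  have xy: "x \<noteq> y" using y tree by (auto simp: neighbors_def regular_tree_def)
  obtain a b c where n: "neighbors E x = {a, b, c}" "a \<noteq> b" "a \<noteq> c" "b \<noteq> c"
    using neighbors_triple[OF tree] by metis
  have int: "integrable M (\<lambda>\<omega>. \<bar>approx m \<omega> i v - approx m \<omega> j w\<bar>)" for i j v w
  proof (rule integrable_of_approx_bound[of _ 1])
    fix \<omega> assume "\<forall>m k x. approx m \<omega> k x \<in> {0..1}"
    then have "approx m \<omega> i v \<in> {0..1}" "approx m \<omega> j w \<in> {0..1}" by blast+
    then show "\<bar>\<bar>approx m \<omega> i v - approx m \<omega> j w\<bar>\<bar> \<le> 1" by auto
  qed simp
  define B where "B = {\<omega> \<in> space M. \<forall>z\<in>{x, y}. rang m \<omega> z k}"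
  have [measurable]: "B \<in> sets M" unfolding B_def by measurable
  have intB: "integrable M (\<lambda>\<omega>. 3 * indicator B \<omega> :: real)"
    by (intro integrable_mult_right integrable_real_indicator) (auto simp: emeasure_eq_measure)
  let ?d = "expectation (gain m k x y)"
  have d: "expectation (gain m k v w) = ?d" if "w \<in> neighbors E v" for v w
    using that y by (rule expectation_gain_eq)
  have "expectation (\<lambda>\<omega>. gain m k x a \<omega> + gain m k x b \<omega> + gain m k x c \<omega> + \<bar>approx m \<omega> (Suc k) x - approx m \<omega> k x\<bar>)
      \<le> expectation (\<lambda>\<omega>. 0)"
    by (intro integral_mono gain_sum_le[OF n] Bochner_Integration.integrable_add integrable_gain int integrable_zero)
  then have 1: "3 * ?d + expectation (\<lambda>\<omega>. \<bar>approx m \<omega> (Suc k) x - approx m \<omega> k x\<bar>) \<le> 0"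
    using d[of a x] d[of b x] d[of c x] n(1) by (simp add: integrable_gain int)
  have "expectation (\<lambda>\<omega>. \<bar>approx m \<omega> (Suc k) x - approx m \<omega> (Suc k) y\<bar>) \<le>
      expectation (\<lambda>\<omega>. \<bar>approx m \<omega> k x - approx m \<omega> k y\<bar> + gain m k x y \<omega> + gain m k y x \<omega> + 3 * indicator B \<omega>)"
  proof (rule integral_mono_AE)
    show "AE \<omega> in M. \<bar>approx m \<omega> (Suc k) x - approx m \<omega> (Suc k) y\<bar> \<le> \<bar>approx m \<omega> k x - approx m \<omega> k y\<bar> +
      gain m k x y \<omega> + gain m k y x \<omega> + 3 * indicator B \<omega>"
      using AE_approx_unit AE_space unfolding B_def by eventually_elim (rule discrepancy_step)
    show "integrable M (\<lambda>\<omega>. \<bar>approx m \<omega> k x - approx m \<omega> k y\<bar> + gain m k x y \<omega> + gain m k y x \<omega> +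
        3 * indicator B \<omega>)"
      by (intro Bochner_Integration.integrable_add integrable_gain int intB)
  qed (rule int)
  also have "\<dots> = expectation (\<lambda>\<omega>. \<bar>approx m \<omega> k x - approx m \<omega> k y\<bar>) + ?d + expectation (gain m k y x) + 3 * prob B"
    by (subst Bochner_Integration.integral_add;
        (intro Bochner_Integration.integrable_add integrable_gain int intB)?)+ simp
  finally have 2: "expectation (\<lambda>\<omega>. \<bar>approx m \<omega> (Suc k) x - approx m \<omega> (Suc k) y\<bar>) \<le>
      expectation (\<lambda>\<omega>. \<bar>approx m \<omega> k x - approx m \<omega> k y\<bar>) + 2 * ?d + 3 * prob B"
    using d[OF x] by simp
  have "prob B \<le> (1 / 2 ^ m) ^ card {x, y}" unfolding B_def by (rule prob_all_rang) simp
  also have "\<dots> = (1 / 4) ^ m" using xy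
    by (simp add: card_insert_if power_divide power2_eq_square power_mult_distrib[symmetric])
  finally have 3: "prob B \<le> (1 / 4) ^ m" .
  have "2 * v \<le> 3 * (e - e') + 9 * q"
    if "3 * d + v \<le> 0" "e' \<le> e + 2 * d + 3 * p" "p \<le> q" for v e e' d p q :: real
    using that by (simp add: algebra_simps)
  from this[OF 1 2 3] show ?thesis .
qed

text \<open>
  Summing \<open>expected_variation_step\<close> telescopes the discrepancies, which lie between 0 and 1.
\<close>
lemma expected_variation:
  "(\<Sum>k<K. expectation (\<lambda>\<omega>. \<bar>approx m \<omega> (Suc k) x - approx m \<omega> k x\<bar>)) \<le> 2 + 5 * real K * (1 / 4) ^ m"
proof -
  obtain a b c where n: "neighbors E x = {a, b, c}" using neighbors_triple[OF tree] by metis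
  define e where "e k = expectation (\<lambda>\<omega>. \<bar>approx m \<omega> k x - approx m \<omega> k a\<bar>)" for k
  have ge: "0 \<le> e k" for k by (simp add: e_def)
  have "e 0 \<le> 1"
    unfolding e_def
  proof (rule integral_le_const)
    show "AE \<omega> in M. \<bar>approx m \<omega> 0 x - approx m \<omega> 0 a\<bar> \<le> 1"
      using AE_approx_unit
    proof eventually_elim
      case (elim \<omega>)
      then have "approx m \<omega> 0 x \<in> {0..1}" "approx m \<omega> 0 a \<in> {0..1}" by blast+
      then show ?case by auto
    qed
    then show "integrable M (\<lambda>\<omega>. \<bar>approx m \<omega> 0 x - approx m \<omega> 0 a\<bar>)"
      by (intro integrable_const_bound[of _ 1]) auto
  qed
  have "2 * (\<Sum>k<K. expectation (\<lambda>\<omega>. \<bar>approx m \<omega> (Suc k) x - approx m \<omega> k x\<bar>)) \<le>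
      3 * (e 0 - e K) + 9 * real K * (1 / 4) ^ m" for K
  proof (induction K)
    case (Suc K)
    then show ?case using expected_variation_step[of a x m K] n
      by (simp add: e_def algebra_simps)
  qed simp
  from this[of K] have "2 * (\<Sum>k<K. expectation (\<lambda>\<omega>. \<bar>approx m \<omega> (Suc k) x - approx m \<omega> k x\<bar>)) \<le>
      3 + 9 * (real K * (1 / 4) ^ m)"
    using ge[of K] \<open>e 0 \<le> 1\<close> by simp
  moreover have "0 \<le> real K * (1 / 4) ^ m" by simp
  moreover have "5 * real K * (1 / 4) ^ m = 5 * (real K * (1 / 4) ^ m)" by simp
  ultimately show ?thesis by linarith
qed

text \<open>
  With time horizon \<open>m\<close> at level \<open>m\<close> the expected variation stays bounded, since \<open>m * 2 ^ m / 4 ^ m \<le> 1\<close>. By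
  Fatou's lemma the lower limit of the variations is finite almost surely, and by agreement of the two dynamics it
  dominates the dyadic variation of the process up to any fixed time.
\<close>
lemma AE_bounded_variation:
  "AE \<omega> in M. \<exists>B. \<forall>m0. \<exists>m\<ge>m0. (\<Sum>k<m * 2 ^ m. \<bar>approx m \<omega> (Suc k) x - approx m \<omega> k x\<bar>) \<le> B"
proof -
  define R where "R m \<omega> = (\<Sum>k<m * 2 ^ m. \<bar>approx m \<omega> (Suc k) x - approx m \<omega> k x\<bar>)" for m \<omega>
  have [measurable]: "R m \<in> borel_measurable M" for m unfolding R_def[abs_def] by measurable
  have int: "integrable M (\<lambda>\<omega>. \<bar>approx m \<omega> (Suc k) x - approx m \<omega> k x\<bar>)" for m k
  proof (rule integrable_of_approx_bound[of _ 1])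
    fix \<omega> assume "\<forall>m k x. approx m \<omega> k x \<in> {0..1}"
    then have "approx m \<omega> (Suc k) x \<in> {0..1}" "approx m \<omega> k x \<in> {0..1}" by blast+
    then show "\<bar>\<bar>approx m \<omega> (Suc k) x - approx m \<omega> k x\<bar>\<bar> \<le> 1" by auto
  qed simp
  have "(\<integral>\<^sup>+\<omega>. ennreal (R m \<omega>) \<partial>M) \<le> 7" for m
  proof -
    have eq: "(\<integral>\<^sup>+\<omega>. ennreal (R m \<omega>) \<partial>M) = ennreal (expectation (R m))"
      unfolding R_def[abs_def] by (intro nn_integral_eq_integral) (auto intro!: int sum_nonneg)
    have "expectation (R m) = (\<Sum>k<m * 2 ^ m. expectation (\<lambda>\<omega>. \<bar>approx m \<omega> (Suc k) x - approx m \<omega> k x\<bar>))"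
      unfolding R_def[abs_def] using int by simp
    also have "\<dots> \<le> 2 + 5 * real (m * 2 ^ m) * (1 / 4) ^ m" by (rule expected_variation)
    also have "\<dots> = 2 + 5 * (real m / 2 ^ m)"
    proof -
      have "2 ^ m * (1 / 4) ^ m = (1 / 2 :: real) ^ m" unfolding power_mult_distrib[symmetric] by simp
      then show ?thesis by (simp add: mult.assoc power_one_over field_simps)
    qed
    also have "\<dots> \<le> 7"
    proof -
      have "real m \<le> 2 ^ m" using of_nat_less_two_power[of m, where 'a = real] by simp
      then have "real m / 2 ^ m \<le> 1" by simp
      then show ?thesis by linarith
    qed
    finally have "expectation (R m) \<le> 7" .
    then have "ennreal (expectation (R m)) \<le> ennreal 7" by (rule ennreal_leI)
    then show ?thesis unfolding eq by simp
  qed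
  then have "(\<integral>\<^sup>+\<omega>. liminf (\<lambda>m. ennreal (R m \<omega>)) \<partial>M) \<le> 7"
    by (intro order.trans[OF nn_integral_liminf] Liminf_le) auto
  then have "(\<integral>\<^sup>+\<omega>. liminf (\<lambda>m. ennreal (R m \<omega>)) \<partial>M) \<noteq> \<infinity>"
    by (auto simp: top_unique)
  then have "AE \<omega> in M. liminf (\<lambda>m. ennreal (R m \<omega>)) \<noteq> \<infinity>"
    by (intro nn_integral_PInf_AE) auto
  then show ?thesis
  proof eventually_elim
    case (elim \<omega>)
    then obtain B where B: "0 \<le> B" "liminf (\<lambda>m. ennreal (R m \<omega>)) = ennreal B"
      by (metis ennreal_cases infinity_ennreal_def)
    \<comment> \<open>The margin 1 is needed because the lower limit need not be attained.\<close>
    have "\<exists>m\<ge>m0. R m \<omega> \<le> B + 1" for m0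
    proof (rule ccontr)
      assume "\<not> (\<exists>m\<ge>m0. R m \<omega> \<le> B + 1)"
      then have "eventually (\<lambda>m. ennreal (B + 1) \<le> ennreal (R m \<omega>)) sequentially"
        by (auto simp: eventually_sequentially intro!: exI[of _ m0] ennreal_leI)
      then have "ennreal (B + 1) \<le> ennreal B" unfolding B(2)[symmetric] by (rule Liminf_bounded)
      then show False using B(1) by (simp add: ennreal_le_iff)
    qed
    then show ?case unfolding R_def by blast
  qed
qed

lemma AE_convergent: "AE \<omega> in M. \<forall>x. ((\<lambda>t. U x t \<omega>) \<longlongrightarrow> limit_value U x \<omega>) at_top"
proof (rule AE_all_vertices)
  fix x
  show "AE \<omega> in M. ((\<lambda>t. U x t \<omega>) \<longlongrightarrow> limit_value U x \<omega>) at_top"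
    using AE_bounded_variation[of x] AE_approx_eq AE_median_path
  proof eventually_elim
    case (elim \<omega>)
    from elim(1) obtain B where
      B: "\<And>m0. \<exists>m\<ge>m0. (\<Sum>k<m * 2 ^ m. \<bar>approx m \<omega> (Suc k) x - approx m \<omega> k x\<bar>) \<le> B" by blast
    have "\<exists>m\<ge>m0. (\<Sum>k<T * 2 ^ m. \<bar>U x (real (Suc k) / 2 ^ m) \<omega> - U x (real k / 2 ^ m) \<omega>\<bar>) \<le> B" for T m0
    proof -
      obtain m1 where m1: "\<And>m k. m \<ge> m1 \<Longrightarrow> k \<le> T * 2 ^ m \<Longrightarrow> approx m \<omega> k x = U x (real k / 2 ^ m) \<omega>"
        using elim(2)[THEN spec[of _ x], THEN spec[of _ T]] by auto
      obtain m where m: "m \<ge> max m0 (max m1 T)"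
        "(\<Sum>k<m * 2 ^ m. \<bar>approx m \<omega> (Suc k) x - approx m \<omega> k x\<bar>) \<le> B"
        using B[of "max m0 (max m1 T)"] by auto
      have "(\<Sum>k<T * 2 ^ m. \<bar>U x (real (Suc k) / 2 ^ m) \<omega> - U x (real k / 2 ^ m) \<omega>\<bar>) =
          (\<Sum>k<T * 2 ^ m. \<bar>approx m \<omega> (Suc k) x - approx m \<omega> k x\<bar>)"
        using m(1) by (intro sum.cong refl) (simp add: m1 del: of_nat_Suc)
      also have "\<dots> \<le> (\<Sum>k<m * 2 ^ m. \<bar>approx m \<omega> (Suc k) x - approx m \<omega> k x\<bar>)"
        using m(1) by (intro sum_mono2) (auto intro: less_le_trans)
      finally show ?thesis using m by (intro exI[of _ m]) auto
    qed
    then have "\<exists>L. ((\<lambda>t. U x t \<omega>) \<longlongrightarrow> L) at_top"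
      by (rule convergent_of_bounded_dyadic_variation[where u = "\<lambda>t. U x t \<omega>"])
        (use median_path_right_constant[OF elim(3), where x = x] in auto)
    then obtain L where L: "((\<lambda>t. U x t \<omega>) \<longlongrightarrow> L) at_top" ..
    then have "limit_value U x \<omega> = L" unfolding limit_value_def by (intro tendsto_Lim) auto
    then show ?case using L by simp
  qed
qed

lemma AE_stationary: "AE \<omega> in M. stationary E (\<lambda>x. limit_value U x \<omega>)"
  using AE_convergent AE_median_path AE_rings_unbounded
proof eventually_elim
  case (elim \<omega>)
  show ?case
    by (rule limit_stationary[OF tree elim(2)]) (use elim(1,3) in \<open>auto simp: rang_eq_cell_flag\<close>)
qed

end

section \<open>Rising paths are bounded\<close>

text \<open>
  The weight of a path in the mass-transport argument, of interest for paths with at least one edge.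
\<close>
definition climb :: "'v set set \<Rightarrow> 'v list \<Rightarrow> ('v \<Rightarrow> real) \<Rightarrow> real" where
  "climb E p v = (if rising E v p then v (p ! 1) - v (p ! 0) else 0)"

lemma rising_conv_nth:
  "rising E v p \<longleftrightarrow> p \<noteq> [] \<and> (\<forall>i<length p - 1. {p ! i, p ! Suc i} \<in> E \<and> v (p ! i) < v (p ! Suc i))"
  by (auto simp: rising_def successively_conv_nth less_diff_conv)

lemma climb_nonneg: "2 \<le> length p \<Longrightarrow> 0 \<le> climb E p v"
  unfolding climb_def rising_conv_nth by (auto simp: less_imp_le)

lemma climb_append:
  assumes "2 \<le> length s"
  shows "climb E (s @ [x]) v \<le> climb E s v"
proof -
  have "s \<noteq> []" using assms by auto
  moreover have "(s @ [x]) ! 0 = s ! 0" "(s @ [x]) ! 1 = s ! 1" using assms by (auto simp: nth_append)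
  ultimately show ?thesis using climb_nonneg[OF assms, of E v]
    by (auto simp: climb_def rising_append)
qed

text \<open>
  There is at most one rising path of each length that ends at \<open>x\<close>, and these paths extend one another downwards,
  so that their first increments telescope.
\<close>
lemma climb_descending_sum_le:
  assumes tr: "regular_tree 3 E" and v: "stationary E v" "\<And>x. 0 \<le> v x"
  shows "(\<Sum>n<N. \<Sum>p\<in>paths_from E x (Suc (Suc n)). climb E (rev p) v) \<le> v x"
proof (induction N arbitrary: x)
  case 0
  show ?case using v(2) by simp
next
  case (Suc N)
  let ?P = "\<lambda>x n. paths_from E x (Suc n)"
  have fin: "finite (?P x n)" for x n by (rule finite_paths_from[OF tr])
  have down: "\<exists>s. p = x # s \<and> s \<in> ?P (hd s) n \<and> {x, hd s} \<in> E \<and> v (hd s) < v x"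
    if p: "p \<in> ?P x (Suc n)" "climb E (rev p) v \<noteq> 0" for p n
  proof -
    obtain s where s: "p = x # s" "s \<noteq> []" using p(1) by (cases p; cases "tl p") (auto simp: paths_from_def)
    have "rising E v (rev s @ [x])" using p(2) s by (auto simp: climb_def split: if_splits)
    then have "{x, hd s} \<in> E" "v (hd s) < v x"
      using s by (auto simp: rising_append last_rev insert_commute)
    then show ?thesis using s p(1) by (auto simp: paths_from_def is_path_Cons)
  qed
  show ?case
  proof (cases "\<exists>z. {x, z} \<in> E \<and> v z < v x")
    case False
    then have "climb E (rev p) v = 0" if "p \<in> ?P x (Suc n)" for p n using down[OF that] by blast
    then show ?thesis using v(2) by simp
  next
    case True
    then obtain z where z: "{x, z} \<in> E" "v z < v x" by blast
    have down': "p \<in> (#) x ` ?P z n" if p: "p \<in> ?P x (Suc n)" "climb E (rev p) v \<noteq> 0" for p n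
    proof -
      obtain s where s: "p = x # s" "s \<in> ?P (hd s) n" "{x, hd s} \<in> E" "v (hd s) < v x"
        using down[OF p] by blast
      have "hd s = z" by (rule stationary_lower_unique[OF tr v(1) s(3,4) z])
      then show ?thesis using s by auto
    qed
    have nonneg: "0 \<le> climb E (rev (x # s)) v" if "s \<in> ?P z n" for s n
      using that by (intro climb_nonneg) (auto simp: paths_from_def)
    have step: "(\<Sum>p\<in>?P x (Suc n). climb E (rev p) v) \<le> (\<Sum>s\<in>?P z n. climb E (rev (x # s)) v)" for n
    proof -
      have "(\<Sum>p\<in>?P x (Suc n). climb E (rev p) v) =
          (\<Sum>p\<in>{p \<in> ?P x (Suc n). climb E (rev p) v \<noteq> 0}. climb E (rev p) v)"
        by (rule sum.mono_neutral_right) (auto simp: fin)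
      also have "\<dots> \<le> (\<Sum>p\<in>(#) x ` ?P z n. climb E (rev p) v)"
        by (rule sum_mono2) (use fin down' nonneg in auto)
      also have "\<dots> = (\<Sum>s\<in>?P z n. climb E (rev (x # s)) v)"
        by (subst sum.reindex) auto
      finally show ?thesis .
    qed
    have "?P z 0 = {[z]}" by (auto simp: paths_from_def is_path_def length_Suc_conv)
    then have first: "(\<Sum>p\<in>?P x (Suc 0). climb E (rev p) v) \<le> v x - v z"
    proof -
      have "climb E (rev [x, z]) v = v x - v z"
        using z by (simp add: climb_def rising_def insert_commute)
      then show ?thesis using step[of 0] \<open>?P z 0 = {[z]}\<close> by simp
    qed
    have later: "(\<Sum>p\<in>?P x (Suc (Suc n)). climb E (rev p) v) \<le> (\<Sum>s\<in>?P z (Suc n). climb E (rev s) v)" for n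
    proof (rule order.trans[OF step sum_mono])
      fix s assume "s \<in> ?P z (Suc n)"
      then show "climb E (rev (x # s)) v \<le> climb E (rev s) v"
        using climb_append[of "rev s" E x v] by (simp add: paths_from_def)
    qed
    have "(\<Sum>n<Suc N. \<Sum>p\<in>?P x (Suc n). climb E (rev p) v) =
        (\<Sum>p\<in>?P x (Suc 0). climb E (rev p) v) + (\<Sum>n<N. \<Sum>p\<in>?P x (Suc (Suc n)). climb E (rev p) v)"
      by (rule sum.lessThan_Suc_shift)
    also have "\<dots> \<le> (v x - v z) + (\<Sum>n<N. \<Sum>s\<in>?P z (Suc n). climb E (rev s) v)"
      using first later by (intro add_mono sum_mono)
    also have "\<dots> \<le> v x" using Suc.IH[of z] by simp
    finally show ?thesis .
  qed
qed

text \<open>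
  All rising paths from \<open>x\<close> make the same first step, so each length contributes the same increment.
\<close>
lemma climb_ascending_ge:
  assumes tr: "regular_tree 3 E" and v: "stationary E v"
    and inf: "\<And>n. \<exists>p. rising E v p \<and> hd p = x \<and> n < length p"
  shows "\<exists>c>0. \<forall>n. c \<le> (\<Sum>p\<in>paths_from E x (Suc (Suc n)). climb E p v)"
proof -
  have ex: "\<exists>p\<in>paths_from E x (Suc (Suc n)). rising E v p" for n
  proof -
    obtain p where p: "rising E v p" "hd p = x" "Suc (Suc n) < length p" using inf by blast
    let ?q = "take (Suc (Suc n)) p"
    have "rising E v (?q @ drop (Suc (Suc n)) p)" using p by simp
    then have "rising E v ?q" by (subst (asm) rising_append) (use p in auto)
    moreover have "hd ?q = x" "length ?q = Suc (Suc n)" using p by auto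
    ultimately show ?thesis using rising_is_path[of E v ?q] unfolding paths_from_def by blast
  qed
  have up: "{x, p ! 1} \<in> E \<and> v x < v (p ! 1) \<and> p ! 0 = x"
    if "p \<in> paths_from E x (Suc (Suc n))" "rising E v p" for p n
  proof -
    have "p ! 0 = x" using that by (cases p) (auto simp: paths_from_def)
    then show ?thesis using that by (auto simp: paths_from_def rising_conv_nth dest: spec[of _ 0])
  qed
  obtain p0 where p0: "p0 \<in> paths_from E x (Suc (Suc 0))" "rising E v p0" using ex by blast
  define c where "c = v (p0 ! 1) - v x"
  have "c \<le> (\<Sum>p\<in>paths_from E x (Suc (Suc n)). climb E p v)" for n
  proof -
    obtain p where p: "p \<in> paths_from E x (Suc (Suc n))" "rising E v p" using ex by blast
    have "p ! 1 = p0 ! 1"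
      using stationary_upper_unique[OF tr v] up[OF p] up[OF p0] by blast
    then have "c = climb E p v" using up[OF p] p(2) by (simp add: climb_def c_def)
    also have "\<dots> \<le> (\<Sum>p\<in>paths_from E x (Suc (Suc n)). climb E p v)"
      using p(1) finite_paths_from[OF tr] by (intro member_le_sum climb_nonneg) (auto simp: paths_from_def)
    finally show ?thesis .
  qed
  moreover have "0 < c" using up[OF p0] by (simp add: c_def)
  ultimately show ?thesis by blast
qed

definition clip :: "real \<Rightarrow> real" where "clip t = max 0 (min 1 t)"

text \<open>
  Invariance passes to the limit values along almost sure convergence, which needs functionals that are
  continuous in the values. These approximate \<open>climb\<close> as \<open>j\<close> tends to infinity.
\<close>
definition soft_climb :: "nat \<Rightarrow> 'v list \<Rightarrow> ('v \<Rightarrow> real) \<Rightarrow> real" where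
  "soft_climb j p v = (v (p ! 1) - v (p ! 0)) * (\<Prod>i<length p - 1. clip (real j * (v (p ! Suc i) - v (p ! i))))"

lemma soft_climb_bound:
  assumes "\<And>x. v x \<in> {0..1}"
  shows "\<bar>soft_climb j p v\<bar> \<le> 1"
proof -
  have "\<bar>v (p ! 1) - v (p ! 0)\<bar> \<le> 1" using assms[of "p ! 1"] assms[of "p ! 0"] by auto
  moreover have "(\<Prod>i<length p - 1. clip (real j * (v (p ! Suc i) - v (p ! i)))) \<in> {0..1}"
    by (auto intro!: prod_nonneg prod_le_1 simp: clip_def)
  ultimately show ?thesis unfolding soft_climb_def abs_mult
    by (intro mult_le_one) auto
qed

lemma soft_climb_map:
  assumes "2 \<le> length p"
  shows "soft_climb j p (\<lambda>x. v (\<phi> x)) = soft_climb j (map \<phi> p) v"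
proof -
  have "p \<noteq> []" using assms by auto
  then show ?thesis using assms unfolding soft_climb_def length_map
    by (intro arg_cong2[of _ _ _ _ "(*)"] prod.cong) auto
qed

lemma tendsto_soft_climb:
  assumes "\<And>x. (\<lambda>n. Z n x) \<longlonglongrightarrow> z x"
  shows "(\<lambda>n. soft_climb j p (Z n)) \<longlonglongrightarrow> soft_climb j p z"
  unfolding soft_climb_def clip_def by (intro tendsto_intros assms)

lemma tendsto_clip: "(\<lambda>j. clip (real j * d)) \<longlonglongrightarrow> (if 0 < d then 1 else 0)"
proof (cases "0 < d")
  case True
  obtain n :: nat where n: "1 / d < real n" using reals_Archimedean2 by blast
  have "clip (real j * d) = 1" if "j \<ge> n" for j
  proof -
    have "1 / d < real j" using n that by linarith
    then have "1 < real j * d" using True by (simp add: field_simps)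
    then show ?thesis by (simp add: clip_def)
  qed
  then have "eventually (\<lambda>j. 1 = clip (real j * d)) sequentially" by (auto simp: eventually_sequentially)
  then show ?thesis using True by (auto intro: tendsto_eventually elim: eventually_mono)
next
  case False
  then have "real j * d \<le> 0" for j by (intro mult_nonneg_nonpos) auto
  moreover have "clip t = 0" if "t \<le> 0" for t using that by (auto simp: clip_def)
  ultimately have "clip (real j * d) = 0" for j by blast
  then show ?thesis using False by simp
qed

lemma soft_climb_tendsto_climb:
  assumes p: "is_path E p"
  shows "(\<lambda>j. soft_climb j p v) \<longlonglongrightarrow> climb E p v"
proof -
  let ?I = "\<lambda>i. if 0 < v (p ! Suc i) - v (p ! i) then 1 else (0::real)"
  have "(\<lambda>j. soft_climb j p v) \<longlonglongrightarrow> (v (p ! 1) - v (p ! 0)) * (\<Prod>i<length p - 1. ?I i)"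
    unfolding soft_climb_def by (intro tendsto_intros tendsto_clip)
  also have "(v (p ! 1) - v (p ! 0)) * (\<Prod>i<length p - 1. ?I i) = climb E p v"
  proof (cases "\<forall>i<length p - 1. v (p ! i) < v (p ! Suc i)")
    case True
    moreover have "{p ! i, p ! Suc i} \<in> E" if "i < length p - 1" for i
      using p that by (auto simp: is_path_def successively_conv_nth)
    moreover have "p \<noteq> []" using p by (simp add: is_path_def)
    ultimately show ?thesis by (simp add: climb_def rising_conv_nth)
  next
    case False
    then obtain i where i: "i < length p - 1" "\<not> v (p ! i) < v (p ! Suc i)" by blast
    then have "(\<Prod>i<length p - 1. ?I i) = 0" by (intro prod_zero) auto
    moreover have "\<not> rising E v p" using i unfolding rising_conv_nth by blast
    ultimately show ?thesis by (simp add: climb_def)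
  qed
  finally show ?thesis .
qed

context median_tree
begin

lemma measurable_soft_climb:
  assumes [measurable]: "\<And>x. (\<lambda>\<omega>. Z \<omega> x) \<in> borel_measurable M"
  shows "(\<lambda>\<omega>. soft_climb j p (Z \<omega>)) \<in> borel_measurable M"
  unfolding soft_climb_def clip_def by measurable

lemma measurable_climb:
  assumes [measurable]: "\<And>x. (\<lambda>\<omega>. Z \<omega> x) \<in> borel_measurable M"
  shows "(\<lambda>\<omega>. climb E p (Z \<omega>)) \<in> borel_measurable M"
  unfolding climb_def rising_conv_nth by measurable

lemma expectation_soft_climb_limit:
  assumes meas: "\<And>n x. (\<lambda>\<omega>. Z n \<omega> x) \<in> borel_measurable M" "\<And>x. (\<lambda>\<omega>. z \<omega> x) \<in> borel_measurable M"
    and unit: "\<And>n. AE \<omega> in M. \<forall>x. Z n \<omega> x \<in> {0..1}"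
    and lim: "AE \<omega> in M. \<forall>x. (\<lambda>n. Z n \<omega> x) \<longlonglongrightarrow> z \<omega> x"
  shows "(\<lambda>n. expectation (\<lambda>\<omega>. soft_climb j p (Z n \<omega>))) \<longlonglongrightarrow> expectation (\<lambda>\<omega>. soft_climb j p (z \<omega>))"
proof (rule integral_dominated_convergence[where w = "\<lambda>_. 1"])
  show "AE \<omega> in M. (\<lambda>n. soft_climb j p (Z n \<omega>)) \<longlonglongrightarrow> soft_climb j p (z \<omega>)"
    using lim by eventually_elim (simp add: tendsto_soft_climb)
  show "AE \<omega> in M. norm (soft_climb j p (Z n \<omega>)) \<le> 1" for n
    using unit[of n] by eventually_elim (simp add: soft_climb_bound)
qed (use meas in \<open>auto intro: measurable_soft_climb\<close>)

text \<open>
  Versions of the values at integer times and of the limit values that are measurable by construction;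
  almost surely they agree with the originals.
\<close>
definition value_at :: "nat \<Rightarrow> 'w \<Rightarrow> 'v \<Rightarrow> real" where
  "value_at n \<omega> x = lim (\<lambda>m. approx m \<omega> (n * 2 ^ m) x)"

definition final :: "'w \<Rightarrow> 'v \<Rightarrow> real" where
  "final \<omega> x = lim (\<lambda>n. value_at n \<omega> x)"

lemma measurable_value_at [measurable]: "(\<lambda>\<omega>. value_at n \<omega> x) \<in> borel_measurable M"
  unfolding value_at_def by (rule borel_measurable_lim_metric) simp

lemma measurable_final [measurable]: "(\<lambda>\<omega>. final \<omega> x) \<in> borel_measurable M"
  unfolding final_def by (rule borel_measurable_lim_metric) simp

lemma AE_value_at:
  "AE \<omega> in M. \<forall>n x. (\<lambda>m. approx m \<omega> (n * 2 ^ m) x) \<longlonglongrightarrow> value_at n \<omega> x \<and> value_at n \<omega> x = U x (real n) \<omega>"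
  using AE_approx_eq
proof eventually_elim
  case (elim \<omega>)
  show ?case
  proof (intro allI)
    fix n x
    obtain m0 where m0: "\<forall>m\<ge>m0. \<forall>k\<le>n * 2 ^ m. approx m \<omega> k x = U x (real k / 2 ^ m) \<omega>"
      using elim[THEN spec[of _ x], THEN spec[of _ n]] by blast
    have "approx m \<omega> (n * 2 ^ m) x = U x (real n) \<omega>" if "m \<ge> m0" for m
    proof -
      have "approx m \<omega> (n * 2 ^ m) x = U x (real (n * 2 ^ m) / 2 ^ m) \<omega>" using m0 that by blast
      then show ?thesis by simp
    qed
    then have "eventually (\<lambda>m. approx m \<omega> (n * 2 ^ m) x = U x (real n) \<omega>) sequentially"
      by (auto simp: eventually_sequentially)
    then have "(\<lambda>m. approx m \<omega> (n * 2 ^ m) x) \<longlonglongrightarrow> U x (real n) \<omega>" by (rule tendsto_eventually)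
    then show "(\<lambda>m. approx m \<omega> (n * 2 ^ m) x) \<longlonglongrightarrow> value_at n \<omega> x \<and> value_at n \<omega> x = U x (real n) \<omega>"
      using limI unfolding value_at_def by auto
  qed
qed

lemma AE_value_at_unit: "AE \<omega> in M. \<forall>n x. value_at n \<omega> x \<in> {0..1}"
  using AE_value_at values_in_unit by eventually_elim auto

lemma AE_final:
  "AE \<omega> in M. \<forall>x. (\<lambda>n. value_at n \<omega> x) \<longlonglongrightarrow> final \<omega> x \<and> final \<omega> x = limit_value U x \<omega>"
  using AE_value_at AE_convergent
proof eventually_elim
  case (elim \<omega>)
  show ?case
  proof
    fix x
    have "(\<lambda>n. U x (real n) \<omega>) \<longlonglongrightarrow> limit_value U x \<omega>"
      using filterlim_compose[OF elim(2)[THEN spec[of _ x]] filterlim_real_sequentially] .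
    then have "(\<lambda>n. value_at n \<omega> x) \<longlonglongrightarrow> limit_value U x \<omega>" using elim(1) by simp
    then show "(\<lambda>n. value_at n \<omega> x) \<longlonglongrightarrow> final \<omega> x \<and> final \<omega> x = limit_value U x \<omega>"
      using limI unfolding final_def by auto
  qed
qed

lemma AE_final_unit: "AE \<omega> in M. \<forall>x. final \<omega> x \<in> {0..1}"
  using AE_final AE_value_at_unit
proof eventually_elim
  case (elim \<omega>)
  show ?case
  proof
    fix x
    have "(\<lambda>n. value_at n \<omega> x) \<longlonglongrightarrow> final \<omega> x" using elim(1) by blast
    then show "final \<omega> x \<in> {0..1}"
      by (rule closed_sequentially[OF closed_atLeastAtMost, rotated]) (use elim(2) in blast)
  qed
qed

lemma AE_final_stationary: "AE \<omega> in M. stationary E (final \<omega>)"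
  using AE_final AE_stationary
proof eventually_elim
  case (elim \<omega>)
  then have "final \<omega> = (\<lambda>x. limit_value U x \<omega>)" by auto
  then show ?case using elim(2) by simp
qed

text \<open>
  Some automorphism reverses \<open>p\<close>. So the identity holds for the synchronous dynamics and the continuous
  functionals \<open>soft_climb\<close>; bounded convergence is applied as first the level, then the time, and finally \<open>j\<close> tends
  to infinity. The parameters cover the limit values and their reflection at once.
\<close>
lemma expectation_climb_rev:
  assumes p: "is_path E p" "2 \<le> length p"
    and W: "(\<alpha> = 0 \<and> \<sigma> = 1) \<or> (\<alpha> = 1 \<and> \<sigma> = (-1 :: real))"
  shows "expectation (\<lambda>\<omega>. climb E p (\<lambda>x. \<alpha> + \<sigma> * final \<omega> x)) =
         expectation (\<lambda>\<omega>. climb E (rev p) (\<lambda>x. \<alpha> + \<sigma> * final \<omega> x))"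
proof -
  let ?q = "rev p"
  have q: "is_path E ?q" using p by (simp add: is_path_rev)
  obtain \<phi> where \<phi>: "automorphism E \<phi>" "map \<phi> p = ?q"
    using tree_path_transitive[OF tree p(1) q] by auto
  have W01: "\<alpha> + \<sigma> * t \<in> {0..1}" if "t \<in> {0..1}" for t using W that by auto
  have approx: "expectation (\<lambda>\<omega>. soft_climb j p (\<lambda>x. \<alpha> + \<sigma> * approx m \<omega> k x)) =
      expectation (\<lambda>\<omega>. soft_climb j ?q (\<lambda>x. \<alpha> + \<sigma> * approx m \<omega> k x))" for j m k
  proof -
    define H where "H r = soft_climb j p (\<lambda>x. \<alpha> + \<sigma> * dyn E (fst r) (snd r) k x)" for r
    have [measurable]: "(\<lambda>r. dyn E (fst r) (snd r) k z) \<in> borel_measurable (initial_space \<Otimes>\<^sub>M flag_space)" for z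
      using measurable_dyn[OF tree, of k z] by (simp add: case_prod_beta)
    have "H \<in> borel_measurable (initial_space \<Otimes>\<^sub>M flag_space)"
      unfolding H_def[abs_def] soft_climb_def clip_def by measurable
    from expectation_automorphism[OF \<phi>(1) this, of m] show ?thesis
      by (simp add: H_def dyn_automorphism[OF \<phi>(1)] approx_def
          soft_climb_map[OF p(2), of j "\<lambda>x. \<alpha> + \<sigma> * dyn E _ _ k x" \<phi>] \<phi>(2))
  qed
  have at: "expectation (\<lambda>\<omega>. soft_climb j p (\<lambda>x. \<alpha> + \<sigma> * value_at n \<omega> x)) =
      expectation (\<lambda>\<omega>. soft_climb j ?q (\<lambda>x. \<alpha> + \<sigma> * value_at n \<omega> x))" for j n
  proof -
    have lim: "(\<lambda>m. expectation (\<lambda>\<omega>. soft_climb j r (\<lambda>x. \<alpha> + \<sigma> * approx m \<omega> (n * 2 ^ m) x))) \<longlonglongrightarrow>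
        expectation (\<lambda>\<omega>. soft_climb j r (\<lambda>x. \<alpha> + \<sigma> * value_at n \<omega> x))" for r
    proof (rule expectation_soft_climb_limit)
      show "AE \<omega> in M. \<forall>x. \<alpha> + \<sigma> * approx m \<omega> (n * 2 ^ m) x \<in> {0..1}" for m
        using AE_approx_unit by eventually_elim (intro allI W01, blast)
      show "AE \<omega> in M. \<forall>x. (\<lambda>m. \<alpha> + \<sigma> * approx m \<omega> (n * 2 ^ m) x) \<longlonglongrightarrow> \<alpha> + \<sigma> * value_at n \<omega> x"
        using AE_value_at by eventually_elim (intro allI tendsto_intros, blast)
    qed auto
    show ?thesis using LIMSEQ_unique[OF lim[of p]] lim[of ?q] approx by simp
  qed
  have fin: "expectation (\<lambda>\<omega>. soft_climb j p (\<lambda>x. \<alpha> + \<sigma> * final \<omega> x)) =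
      expectation (\<lambda>\<omega>. soft_climb j ?q (\<lambda>x. \<alpha> + \<sigma> * final \<omega> x))" for j
  proof -
    have lim: "(\<lambda>n. expectation (\<lambda>\<omega>. soft_climb j r (\<lambda>x. \<alpha> + \<sigma> * value_at n \<omega> x))) \<longlonglongrightarrow>
        expectation (\<lambda>\<omega>. soft_climb j r (\<lambda>x. \<alpha> + \<sigma> * final \<omega> x))" for r
    proof (rule expectation_soft_climb_limit)
      show "AE \<omega> in M. \<forall>x. \<alpha> + \<sigma> * value_at n \<omega> x \<in> {0..1}" for n
        using AE_value_at_unit by eventually_elim (intro allI W01, blast)
      show "AE \<omega> in M. \<forall>x. (\<lambda>n. \<alpha> + \<sigma> * value_at n \<omega> x) \<longlonglongrightarrow> \<alpha> + \<sigma> * final \<omega> x"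
        using AE_final by eventually_elim (intro allI tendsto_intros, blast)
    qed auto
    show ?thesis using LIMSEQ_unique[OF lim[of p]] lim[of ?q] at by simp
  qed
  have lim: "(\<lambda>j. expectation (\<lambda>\<omega>. soft_climb j r (\<lambda>x. \<alpha> + \<sigma> * final \<omega> x))) \<longlonglongrightarrow>
      expectation (\<lambda>\<omega>. climb E r (\<lambda>x. \<alpha> + \<sigma> * final \<omega> x))" if r: "is_path E r" for r
  proof (rule integral_dominated_convergence[where w = "\<lambda>_. 1"])
    show "AE \<omega> in M. (\<lambda>j. soft_climb j r (\<lambda>x. \<alpha> + \<sigma> * final \<omega> x)) \<longlonglongrightarrow> climb E r (\<lambda>x. \<alpha> + \<sigma> * final \<omega> x)"
      by (rule AE_I2) (rule soft_climb_tendsto_climb[OF r])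
    show "AE \<omega> in M. norm (soft_climb j r (\<lambda>x. \<alpha> + \<sigma> * final \<omega> x)) \<le> 1" for j
      using AE_final_unit
    proof eventually_elim
      case (elim \<omega>)
      then have "\<bar>soft_climb j r (\<lambda>x. \<alpha> + \<sigma> * final \<omega> x)\<bar> \<le> 1"
        by (intro soft_climb_bound W01) blast
      then show ?case by simp
    qed
  qed (auto intro!: measurable_soft_climb measurable_climb)
  show ?thesis using LIMSEQ_unique[OF lim[OF p(1)]] lim[OF q] fin by simp
qed

text \<open>
  The expected weights \<open>R n\<close> of the rising paths from \<open>x\<close> equal those of the rising paths to \<open>x\<close>, whose
  sum over \<open>n\<close> is at most 1. Hence \<open>R n\<close> is almost surely summable, which excludes rising paths of all
  lengths from \<open>x\<close>.
\<close>
lemma AE_rising_bounded: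
  assumes [measurable]: "\<And>x. (\<lambda>\<omega>. W \<omega> x) \<in> borel_measurable M"
    and unit: "AE \<omega> in M. \<forall>x. W \<omega> x \<in> {0..1}"
    and stat: "AE \<omega> in M. stationary E (W \<omega>)"
    and rev: "\<And>p. is_path E p \<Longrightarrow> 2 \<le> length p \<Longrightarrow>
      expectation (\<lambda>\<omega>. climb E p (W \<omega>)) = expectation (\<lambda>\<omega>. climb E (rev p) (W \<omega>))"
  shows "AE \<omega> in M. \<forall>x. \<exists>n. \<forall>p. rising E (W \<omega>) p \<and> hd p = x \<longrightarrow> length p \<le> n"
proof (rule AE_all_vertices)
  fix x
  let ?P = "\<lambda>n. paths_from E x (Suc (Suc n))"
  define R where "R n \<omega> = (\<Sum>p\<in>?P n. climb E p (W \<omega>))" for n \<omega>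
  define R' where "R' n \<omega> = (\<Sum>p\<in>?P n. climb E (rev p) (W \<omega>))" for n \<omega>
  have [measurable]: "(\<lambda>\<omega>. climb E p (W \<omega>)) \<in> borel_measurable M" for p by (rule measurable_climb) simp
  have int: "integrable M (\<lambda>\<omega>. climb E p (W \<omega>))" for p
  proof (rule integrable_const_bound[of _ 1])
    show "AE \<omega> in M. norm (climb E p (W \<omega>)) \<le> 1"
      using unit
    proof eventually_elim
      case (elim \<omega>)
      then have "W \<omega> (p ! 1) \<in> {0..1}" "W \<omega> (p ! 0) \<in> {0..1}" by blast+
      then show ?case by (auto simp: climb_def)
    qed
  qed simp
  have [measurable]: "R n \<in> borel_measurable M" for n unfolding R_def[abs_def] by simp
  have R0: "0 \<le> R n \<omega>" for n \<omega>
    unfolding R_def by (intro sum_nonneg climb_nonneg) (auto simp: paths_from_def)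
  have iR: "integrable M (R n)" "integrable M (R' n)" for n
    unfolding R_def[abs_def] R'_def[abs_def] by (auto intro!: int)
  have eq: "expectation (R n) = expectation (R' n)" for n
  proof -
    have "expectation (R n) = (\<Sum>p\<in>?P n. expectation (\<lambda>\<omega>. climb E p (W \<omega>)))"
      unfolding R_def[abs_def] by (intro Bochner_Integration.integral_sum int)
    also have "\<dots> = (\<Sum>p\<in>?P n. expectation (\<lambda>\<omega>. climb E (rev p) (W \<omega>)))"
      by (intro sum.cong refl rev) (auto simp: paths_from_def)
    also have "\<dots> = expectation (R' n)"
      unfolding R'_def[abs_def] by (intro Bochner_Integration.integral_sum[symmetric] int)
    finally show ?thesis .
  qed
  have partial: "(\<Sum>n<K. expectation (R n)) \<le> 1" for K
  proof -
    have "(\<Sum>n<K. expectation (R n)) = expectation (\<lambda>\<omega>. \<Sum>n<K. R' n \<omega>)"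
      unfolding eq by (intro Bochner_Integration.integral_sum[symmetric] iR)
    also have "\<dots> \<le> 1"
    proof (rule integral_le_const)
      show "integrable M (\<lambda>\<omega>. \<Sum>n<K. R' n \<omega>)" by (intro Bochner_Integration.integrable_sum iR)
      show "AE \<omega> in M. (\<Sum>n<K. R' n \<omega>) \<le> 1"
        using unit stat
      proof eventually_elim
        case (elim \<omega>)
        have "(\<Sum>n<K. R' n \<omega>) \<le> W \<omega> x"
          unfolding R'_def by (rule climb_descending_sum_le[OF tree elim(2)]) (use elim(1) in auto)
        also have "W \<omega> x \<le> 1" using elim(1) by auto
        finally show ?case .
      qed
    qed
    finally show ?thesis .
  qed
  have "(\<integral>\<^sup>+\<omega>. (\<Sum>n. ennreal (R n \<omega>)) \<partial>M) = (\<Sum>n. \<integral>\<^sup>+\<omega>. ennreal (R n \<omega>) \<partial>M)"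
    by (rule nn_integral_suminf) simp
  also have "\<dots> = (\<Sum>n. ennreal (expectation (R n)))"
    by (intro suminf_cong nn_integral_eq_integral iR AE_I2 R0)
  also have "\<dots> \<le> 1"
    unfolding suminf_eq_SUP
  proof (rule SUP_least)
    fix K
    have "(\<Sum>n<K. ennreal (expectation (R n))) = ennreal (\<Sum>n<K. expectation (R n))"
      by (intro sum_ennreal Bochner_Integration.integral_nonneg R0)
    then show "(\<Sum>n<K. ennreal (expectation (R n))) \<le> 1" using partial[of K] by (simp add: ennreal_le_1)
  qed
  finally have "(\<integral>\<^sup>+\<omega>. (\<Sum>n. ennreal (R n \<omega>)) \<partial>M) \<noteq> \<infinity>" by (auto simp: top_unique)
  then have "AE \<omega> in M. (\<Sum>n. ennreal (R n \<omega>)) \<noteq> \<infinity>"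
    by (intro nn_integral_PInf_AE) auto
  with stat show "AE \<omega> in M. \<exists>n. \<forall>p. rising E (W \<omega>) p \<and> hd p = x \<longrightarrow> length p \<le> n"
  proof eventually_elim
    case (elim \<omega>)
    show ?case
    proof (rule ccontr)
      assume "\<not> (\<exists>n. \<forall>p. rising E (W \<omega>) p \<and> hd p = x \<longrightarrow> length p \<le> n)"
      then have "\<exists>p. rising E (W \<omega>) p \<and> hd p = x \<and> n < length p" for n by (meson not_le)
      from climb_ascending_ge[OF tree elim(1) this] obtain c where c: "0 < c" "\<And>n. c \<le> R n \<omega>"
        unfolding R_def by blast
      obtain B where B: "0 \<le> B" "(\<Sum>n. ennreal (R n \<omega>)) = ennreal B"
        using elim(2) by (cases "\<Sum>n. ennreal (R n \<omega>)") auto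
      obtain K :: nat where K: "B < real K * c" using reals_Archimedean3[OF c(1)] by blast
      have "ennreal (real K * c) = (\<Sum>n<K. ennreal c)"
        using c(1) by (simp add: ennreal_mult ennreal_of_nat_eq_real_of_nat)
      also have "\<dots> \<le> (\<Sum>n<K. ennreal (R n \<omega>))" by (intro sum_mono ennreal_leI c)
      also have "\<dots> \<le> (\<Sum>n. ennreal (R n \<omega>))" by (rule sum_le_suminf) auto
      finally have "ennreal (real K * c) \<le> ennreal B" unfolding B(2) .
      then show False using K B(1) by (simp add: ennreal_le_iff)
    qed
  qed
qed

lemma AE_component_path:
  "AE \<omega> in M. \<forall>C\<in>graph_components (disagreement_edges E U \<omega>).
     \<exists>p. is_path E p \<and> C = set p \<and> {e \<in> disagreement_edges E U \<omega>. e \<subseteq> C} = path_edges p"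
proof -
  have up: "AE \<omega> in M. \<forall>x. \<exists>n. \<forall>p. rising E (final \<omega>) p \<and> hd p = x \<longrightarrow> length p \<le> n"
    by (rule AE_rising_bounded)
      (use AE_final_unit AE_final_stationary expectation_climb_rev[of _ 0 1] in simp_all)
  have down: "AE \<omega> in M. \<forall>x. \<exists>n. \<forall>p. rising E (\<lambda>x. 1 - final \<omega> x) p \<and> hd p = x \<longrightarrow> length p \<le> n"
  proof (rule AE_rising_bounded)
    show "AE \<omega> in M. \<forall>x. 1 - final \<omega> x \<in> {0..1}"
      using AE_final_unit by eventually_elim auto
    show "AE \<omega> in M. stationary E (\<lambda>x. 1 - final \<omega> x)"
      using AE_final_stationary by eventually_elim (rule stationary_reflect[OF tree])
    show "expectation (\<lambda>\<omega>. climb E p (\<lambda>x. 1 - final \<omega> x)) =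
        expectation (\<lambda>\<omega>. climb E (rev p) (\<lambda>x. 1 - final \<omega> x))" if "is_path E p" "2 \<le> length p" for p
      using expectation_climb_rev[OF that, of 1 "-1"] by simp
  qed simp
  show ?thesis
    using up down AE_final AE_final_stationary
  proof eventually_elim
    case (elim \<omega>)
    have D: "disagreement_edges E U \<omega> = {{x, y} | x y. {x, y} \<in> E \<and> final \<omega> x \<noteq> final \<omega> y}"
      using elim(3) by (simp add: disagreement_edges_def)
    have down: "\<exists>n. \<forall>p. rising E (final \<omega>) p \<and> last p = x \<longrightarrow> length p \<le> n" for x
    proof -
      obtain n where n: "\<And>p. rising E (\<lambda>x. 1 - final \<omega> x) p \<Longrightarrow> hd p = x \<Longrightarrow> length p \<le> n"
        using elim(2)[THEN spec[of _ x]] by auto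
      have "length p \<le> n" if "rising E (final \<omega>) p" "last p = x" for p
        using n[of "rev p"] that by (simp add: rising_rev_reflect hd_rev)
      then show ?thesis by blast
    qed
    show ?case
      by (intro ballI component_is_rising_path[OF tree elim(4) elim(1)[THEN spec] down D])
  qed
qed

end

theorem theorem1p9:
  fixes M :: "'w measure"
    and E :: "'v set set"
    and N :: "'v \<Rightarrow> real \<Rightarrow> 'w \<Rightarrow> nat"
    and U :: "'v \<Rightarrow> real \<Rightarrow> 'w \<Rightarrow> real"
  assumes "regular_tree 3 E"
    and "median_process M E N U"
  shows "(AE \<omega> in M. \<forall>C \<in> graph_components (disagreement_edges E U \<omega>). finite C) \<and>
         (AE \<omega> in M. \<forall>C \<in> graph_components (disagreement_edges E U \<omega>).
            \<exists>w\<in>C. \<exists>z\<in>C. \<exists>p. path_between E w p z \<and>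
              C = set p \<and> {e \<in> disagreement_edges E U \<omega>. e \<subseteq> C} = path_edges p)"
proof -
  interpret median_tree M E N U
    using assms by (simp add: median_tree_def median_tree_axioms_def)
  show ?thesis
  proof
    show "AE \<omega> in M. \<forall>C \<in> graph_components (disagreement_edges E U \<omega>). finite C"
      using AE_component_path by eventually_elim auto
    show "AE \<omega> in M. \<forall>C \<in> graph_components (disagreement_edges E U \<omega>).
            \<exists>w\<in>C. \<exists>z\<in>C. \<exists>p. path_between E w p z \<and>
              C = set p \<and> {e \<in> disagreement_edges E U \<omega>. e \<subseteq> C} = path_edges p"
      using AE_component_path
    proof eventually_elim
      case (elim \<omega>)
      show ?case
      proof
        fix C assume "C \<in> graph_components (disagreement_edges E U \<omega>)"
        then have "\<exists>p. is_path E p \<and> C = set p \<and> {e \<in> disagreement_edges E U \<omega>. e \<subseteq> C} = path_edges p"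
          by (rule bspec[OF elim])
        then obtain p where p: "is_path E p" "C = set p"
          "{e \<in> disagreement_edges E U \<omega>. e \<subseteq> C} = path_edges p" by (elim exE conjE)
        then have "hd p \<in> C" "last p \<in> C" "path_between E (hd p) p (last p)"
          by (auto simp: path_between_def is_path_def)
        then show "\<exists>w\<in>C. \<exists>z\<in>C. \<exists>p. path_between E w p z \<and>
              C = set p \<and> {e \<in> disagreement_edges E U \<omega>. e \<subseteq> C} = path_edges p"
          using p(2,3) by blast
      qed
    qed
  qed
qed

end
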